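(* Let $\mathcal Z=\mathcal Z_1$ be the Zorich map described in the context with $\nu=1$ and $\lambda>\max\{L^5,2L\}$. For $(s_1,s_2,\dots)\in(\mathbb Z^2)^{\mathbb N}$, the set $\{x\in\mathbb R^3:S(x)=(s_1,s_2,\dots)\}$ has three-dimensional Lebesgue measure zero; that is, every fiber of the itinerary map $S$ is a Lebesgue null set.
   Context: Zorich maps. Let $Q=\{(x_1,x_2)\in\mathbb R^2:|x_1|\le1,|x_2|\le1\}$. Let $L\ge1$ and let $\mathfrak h=(\mathfrak h_1,\mathfrak h_2,\mathfrak h_3)$ be a sense-preserving $L$-bi-Lipschitz map (i.e. $|a-b|/L\le|\mathfrak h(a)-\mathfrak h(b)|\le L|a-b|$) of $Q$ onto the closed upper unit hemisphere $\{x\in\mathbb R^3:|x|=1,x_3\ge0\}$, with $\partial Q$ mapped onto the equator. Assume $\mathfrak h_1(t,t)=\mathfrak h_2(t,t)$ and $\mathfrak h_1(t,-t)=-\mathfrak h_2(t,-t)$ for $t\in[-1,1]$ (so $\mathfrak h(0,0)=(0,0,1)$). Let $\lambda\ge1$ and $h(x_1,x_2)=\lambda\mathfrak h(x_1/\lambda,x_2/\lambda)$ on $\lambda Q=[-\lambda,\lambda]^2$. For $\nu>0$ set $\mathcal Z_\nu(x_1,x_2,x_3)=\nu e^{x_3}h(x_1,x_2)$ on $\lambda Q\times\mathbb R$ (which is mapped onto $\{x_3\ge0\}$), and extend $\mathcal Z_\nu$ to $\mathbb R^3$ by repeated reflection: in the domain across the faces $x_1=(2k+1)\lambda$, $x_2=(2k+1)\lambda$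 ($k\in\mathbb Z$) of the beams, and in the range across the plane $x_3=0$. Itineraries. Let $B_{(0,0)}=\{x:0<x_1-x_2<2\lambda,|x_1+x_2|<2\lambda\}$, $B_{(0,-1)}=\{x:-2\lambda<x_1-x_2<0,|x_1+x_2|<2\lambda\}$, and $T_{(0,0)}=B_{(0,0)}\cup B_{(0,-1)}\cup\{x:x_1=x_2-2\lambda,\,-2\lambda<x_1\le0\}\cup\{x:x_1=-x_2+2\lambda,\,0\le x_1<2\lambda\}\cup\{x:x_1=x_2,\,-\lambda<x_1<\lambda\}$, and $T_{(i,j)}=T_{(0,0)}+2i(\lambda,\lambda,0)+2j(\lambda,-\lambda,0)$ for $(i,j)\in\mathbb Z^2$; these sets partition $\mathbb R^3$. For $x\in\mathbb R^3$ its itinerary is $S(x)=(s_1,s_2,\dots)$ with $s_k\in\mathbb Z^2$ determined by $\mathcal Z^k(x)\in T_{s_k}$. *)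

theory Defs
  imports "HOL-Complex_Analysis.Complex_Analysis"
begin

definition sqQ :: "(real^2) set" where
  "sqQ = {a. \<bar>a$1\<bar> \<le> 1 \<and> \<bar>a$2\<bar> \<le> 1}"

definition sqQ_boundary :: "(real^2) set" where
  "sqQ_boundary = {a \<in> sqQ. \<bar>a$1\<bar> = 1 \<or> \<bar>a$2\<bar> = 1}"

definition upper_hemisphere :: "(real^3) set" where
  "upper_hemisphere = {y. norm y = 1 \<and> y$3 \<ge> 0}"

definition equator :: "(real^3) set" where
  "equator = {y. norm y = 1 \<and> y$3 = 0}"

definition sqQ_loop :: "real \<Rightarrow> complex" where
  "sqQ_loop = linepath (Complex 1 (-1)) (Complex 1 1) +++ linepath (Complex 1 1) (Complex (-1) 1)
     +++ linepath (Complex (-1) 1) (Complex (-1) (-1)) +++ linepath (Complex (-1) (-1)) (Complex 1 (-1))"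

definition c2v :: "complex \<Rightarrow> real^2" where
  "c2v z = vector [Re z, Im z]"

definition horiz :: "real^3 \<Rightarrow> complex" where
  "horiz y = Complex (y$1) (y$2)"

text \<open>Sense-preserving map of Q onto the upper hemisphere (boundary onto equator):
  the image of the positively oriented boundary of Q, projected vertically to the
  (x1,x2)-plane, winds once positively around the origin.\<close>
definition sense_preserving_hemi :: "(real^2 \<Rightarrow> real^3) \<Rightarrow> bool" where
  "sense_preserving_hemi hh \<longleftrightarrow> winding_number (\<lambda>t. horiz (hh (c2v (sqQ_loop t)))) 0 = 1"

text \<open>Index m of the strip [(2m-1)lam, (2m+1)lam] containing t, and the folded coordinate
  obtained by repeated reflection across the lines t = (2k+1) lam.\<close>
definition strip_idx :: "real \<Rightarrow> real \<Rightarrow> int" where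
  "strip_idx lam t = \<lfloor>(t + lam) / (2 * lam)\<rfloor>"

definition fold_coord :: "real \<Rightarrow> real \<Rightarrow> real" where
  "fold_coord lam t = (let m = strip_idx lam t; r = t - 2 * real_of_int m * lam
                       in if even m then r else - r)"

text \<open>Zorich map Z_nu built from hh with scaling lam: on the beam lam Q x R it is
  nu e^{x3} lam hh(x1/lam, x2/lam); extended by reflections in the domain across the faces
  x_i = (2k+1) lam and correspondingly in the range across the plane x3 = 0.\<close>
definition zorich :: "(real^2 \<Rightarrow> real^3) \<Rightarrow> real \<Rightarrow> real \<Rightarrow> real^3 \<Rightarrow> real^3" where
  "zorich hh lam nu x =
     (let m = strip_idx lam (x$1) + strip_idx lam (x$2);
          y = (nu * exp (x$3) * lam) *\<^sub>R hh (vector [fold_coord lam (x$1) / lam, fold_coord lam (x$2) / lam])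
      in vector [y$1, y$2, (if even m then y$3 else - (y$3))])"

definition T00 :: "real \<Rightarrow> real^3 \<Rightarrow> bool" where
  "T00 lam x \<longleftrightarrow> (let a = x$1; b = x$2 in
      (0 < a - b \<and> a - b < 2*lam \<and> \<bar>a + b\<bar> < 2*lam)
    \<or> (-2*lam < a - b \<and> a - b < 0 \<and> \<bar>a + b\<bar> < 2*lam)
    \<or> (a = b - 2*lam \<and> -2*lam < a \<and> a \<le> 0)
    \<or> (a = -b + 2*lam \<and> 0 \<le> a \<and> a < 2*lam)
    \<or> (a = b \<and> -lam < a \<and> a < lam))"

definition Ttile :: "real \<Rightarrow> int \<times> int \<Rightarrow> (real^3) set" where
  "Ttile lam ij = {x. T00 lam (x - vector [2 * real_of_int (fst ij) * lam + 2 * real_of_int (snd ij) * lam,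
                                          2 * real_of_int (fst ij) * lam - 2 * real_of_int (snd ij) * lam, 0])}"

text \<open>Fiber of the itinerary map: points x with Z^k(x) \<in> T_{s_k} for all k \<ge> 1;
  here s_k is represented as s (k-1).\<close>
definition itinerary_fiber :: "(real^3 \<Rightarrow> real^3) \<Rightarrow> real \<Rightarrow> (nat \<Rightarrow> int \<times> int) \<Rightarrow> (real^3) set" where
  "itinerary_fiber Z lam s = {x. \<forall>k. (Z ^^ Suc k) x \<in> Ttile lam (s k)}"

end

(* Write a_n for the height (third coordinate) of the n-th point of an orbit, S_n = a_0 + ... + a_(n-1), and D
   for the distance to the invariant plane x1 = x2. The map expands volume at x by at least r exp(3 x3) for
   every r < lam / L^2, while D grows by at most a factor L exp(x3). Since lam > L^5, the product J_n of the
   first n volume factors is at least c^n (D_n / D_0)^3 for some c > 1.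

   The map is injective on a tile up to null sets, so the integral over a fiber of J_n w(Z^n x) is at most the
   integral of w over a tile. For w = 1 / (1 + x3^2) and 1 < theta < c, Borel-Cantelli shows that almost every
   point of the fiber satisfies J_n < theta^n (1 + a_n^2) for all large n. Together with the lower bound for J_n
   this forces D_n to be tiny whenever a_n is bounded, hence the next point is not far below the plane x3 = 0;
   a low point can only come after a high one. After a very low point the orbit shadows that of the origin,
   which climbs like an iterated exponential, and when it leaves, the sum S_n has recovered the loss. So S_n
   does not tend to minus infinity at the rate required by J_n < theta^n (1 + a_n^2), a contradiction. *)
theory Submission
  imports Defs "HOL-Real_Asymp.Real_Asymp"
begin

text \<open>\<open>hh\<close> is merely bi-Lipschitz, so the volume factor of \<open>Z\<close> is
  found without derivatives: \<open>Z\<close> is compared with a piecewise affine map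
  \<open>\<phi>\<close> of known volume factor, whose distances are bounded by those of
  \<open>Z\<close>. The exponent 5 is 2 + 3: two powers of L are lost in the volume factor, three in
  the cube of D. Since lam / L^5 may be arbitrarily close to 1, no step may lose a dimensional
  constant; this dictates balls in the covering argument and thin slabs in the integration.

  The obstacle is that the volume factor carries exp(3 x3), so one low point can undo all expansion
  gained so far. The remedy is norm (Z x) = lam exp(x3): a point at height -h is sent to distance
  lam exp(-h) from the origin, and each step multiplies the shadowing error by at most about the
  exponential of the height reached. Hence the error reaches 1 only when the heights met on the way
  add up to about h. The weight 1 / (1 + x3^2) is there because tiles have infinite volume; its
  reciprocal is at most exponential in the previous height, so the same sum absorbs it.\<close>

subsection \<open>Images under Lipschitz and affine maps\<close>

text \<open>A K-Lipschitz map takes a ball into a ball K times as large, so a cover by disjoint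
  balls gives the factor K^d with no further constant.\<close>

lemma emeasure_lipschitz_image_le:
  fixes f \<phi> :: "'b \<Rightarrow> 'a::euclidean_space"
  assumes K: "K > 0"
    and lip: "\<And>x x'. x \<in> S \<Longrightarrow> x' \<in> S \<Longrightarrow> dist (\<phi> x) (\<phi> x') \<le> K * dist (f x) (f x')"
    and fS: "f ` S \<subseteq> B" and B: "B \<in> sets lebesgue" and meas: "\<phi> ` S \<in> sets lebesgue"
  shows "emeasure lebesgue (\<phi> ` S) \<le> ennreal (K ^ DIM('a)) * emeasure lebesgue B"
proof (rule ennreal_le_epsilon)
  fix e' :: real assume "e' > 0"
  define e where "e = e' / K ^ DIM('a)"
  have e: "e > 0" using \<open>e' > 0\<close> K by (simp add: e_def)
  obtain U where U: "open U" "B \<subseteq> U" "emeasure lebesgue (U - B) < ennreal e" "U - B \<in> lmeasurable"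
    using sets_lebesgue_outer_open[OF B e] by metis
  \<comment> \<open>\<open>lip\<close> forces \<open>\<phi>\<close> to agree wherever
    \<open>f\<close> does, so \<open>\<phi>\<close> factors through \<open>f\<close>.\<close>
  define g where "g = (\<lambda>y. \<phi> (inv_into S f y))"
  have gf: "g (f x) = \<phi> x" if "x \<in> S" for x
    using lip[OF inv_into_into[of "f x" f S] that] that by (simp add: g_def f_inv_into_f)
  have lipg: "dist (g y) (g z) \<le> K * dist y z" if "y \<in> f ` S" "z \<in> f ` S" for y z
    using that lip gf by auto
  define J where "J = {(y, r). y \<in> f ` S \<and> 0 < r \<and> ball y r \<subseteq> U}"
  have cov: "\<exists>i. i \<in> J \<and> x \<in> ball (fst i) (snd i) \<and> snd i < d" if x: "x \<in> f ` S" "0 < d" for x d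
  proof -
    have "x \<in> U" using x fS U by auto
    then obtain k where k: "k > 0" "ball x k \<subseteq> U"
      using U(1) openE by blast
    have "ball x (min k (d/2)) \<subseteq> U" using k by (auto simp: min_def ball_def)
    then show ?thesis using k x by (intro exI[of _ "(x, min k (d/2))"]) (auto simp: J_def)
  qed
  obtain C where C: "countable C" "C \<subseteq> J"
     "pairwise (\<lambda>i j. disjnt (ball (fst i) (snd i)) (ball (fst j) (snd j))) C"
     "negligible (f ` S - (\<Union>i \<in> C. ball (fst i) (snd i)))"
    using Vitali_covering_theorem_balls[of "f ` S" J fst snd, OF cov] by blast
  define I where "I = to_nat_on C ` C"
  define c where "c = from_nat_into C"
  have cI: "c n \<in> C" if "n \<in> I" for n using that C(1) by (auto simp: I_def c_def)
  have inj: "inj_on c I" using C(1) by (auto simp: I_def c_def inj_on_def)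
  have sur: "C = c ` I" using C(1) by (auto simp: I_def c_def image_image)
  define X where "X n = (if n \<in> I then ball (fst (c n)) (snd (c n)) else {})" for n
  define Y where "Y n = (if n \<in> I then cball (g (fst (c n))) (K * snd (c n)) else {})" for n
  have r0: "snd (c n) > 0" if "n \<in> I" for n using cI[OF that] C(2) by (auto simp: J_def)
  have dX: "disjoint_family X"
    unfolding disjoint_family_on_def
  proof (intro ballI impI)
    fix m n :: nat assume "m \<noteq> n"
    show "X m \<inter> X n = {}"
    proof (cases "m \<in> I \<and> n \<in> I")
      case True
      then have "c m \<noteq> c n" using inj \<open>m \<noteq> n\<close> by (auto simp: inj_on_def)
      then show ?thesis using C(3) cI True by (auto simp: X_def pairwise_def disjnt_def)
    qed (auto simp: X_def)
  qed
  have YX: "emeasure lebesgue (Y n) = ennreal (K ^ DIM('a)) * emeasure lebesgue (X n)" for n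
    using r0[of n] K by (auto simp: X_def Y_def emeasure_ball emeasure_cball power_mult_distrib
        ennreal_mult'[symmetric] mult_ac)
  \<comment> \<open>The balls miss only a null part of the image of \<open>f\<close>, and the
    Lipschitz map \<open>g\<close> keeps it null.\<close>
  have neg: "negligible (g ` (f ` S - (\<Union>i \<in> C. ball (fst i) (snd i))))"
  proof (rule negligible_locally_Lipschitz_image[OF _ C(4)])
    show "DIM('a) \<le> DIM('a)" by simp
    fix x assume x: "x \<in> f ` S - (\<Union>i \<in> C. ball (fst i) (snd i))"
    show "\<exists>T b. open T \<and> x \<in> T \<and>
            (\<forall>y\<in>(f ` S - (\<Union>i\<in>C. ball (fst i) (snd i))) \<inter> T. norm (g y - g x) \<le> b * norm (y - x))"
      using x lipg by (intro exI[of _ UNIV] exI[of _ K]) (auto simp: dist_norm)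
  qed
  have sub: "\<phi> ` S \<subseteq> g ` (f ` S - (\<Union>i \<in> C. ball (fst i) (snd i))) \<union> (\<Union>n. Y n)"
  proof
    fix z assume "z \<in> \<phi> ` S"
    then obtain x where x: "x \<in> S" "z = g (f x)" using gf by auto
    show "z \<in> g ` (f ` S - (\<Union>i \<in> C. ball (fst i) (snd i))) \<union> (\<Union>n. Y n)"
    proof (cases "f x \<in> (\<Union>i \<in> C. ball (fst i) (snd i))")
      case True
      then obtain n where n: "n \<in> I" "f x \<in> ball (fst (c n)) (snd (c n))" using sur by auto
      have "fst (c n) \<in> f ` S" using cI[OF n(1)] C(2) by (auto simp: J_def)
      then have "dist (g (fst (c n))) (g (f x)) \<le> K * dist (fst (c n)) (f x)"
        using lipg x by blast
      also have "\<dots> \<le> K * snd (c n)" using n K by simp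
      finally have "z \<in> Y n" using n x by (simp add: Y_def)
      then show ?thesis by blast
    next
      case False
      then show ?thesis using x by blast
    qed
  qed
  have Ym: "Y n \<in> sets lebesgue" for n by (auto simp: Y_def)
  have Xm: "X n \<in> sets lebesgue" for n by (auto simp: X_def)
  have UX: "(\<Union>n. X n) \<subseteq> U"
    using cI C(2) by (fastforce simp: X_def J_def split: if_splits)
  have "emeasure lebesgue (\<phi> ` S) \<le> emeasure lebesgue (g ` (f ` S - (\<Union>i \<in> C. ball (fst i) (snd i))) \<union> (\<Union>n. Y n))"
    using sub neg Ym by (intro emeasure_mono) (auto simp: negligible_iff_null_sets)
  also have "\<dots> \<le> emeasure lebesgue (g ` (f ` S - (\<Union>i \<in> C. ball (fst i) (snd i)))) + emeasure lebesgue (\<Union>n. Y n)"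
    using neg Ym by (intro emeasure_subadditive) (auto simp: negligible_iff_null_sets)
  also have "\<dots> = emeasure lebesgue (\<Union>n. Y n)"
    using neg by (auto simp: negligible_iff_null_sets null_sets_def)
  also have "\<dots> \<le> (\<Sum>n. emeasure lebesgue (Y n))"
    using Ym by (intro emeasure_subadditive_countably) auto
  also have "\<dots> = ennreal (K ^ DIM('a)) * (\<Sum>n. emeasure lebesgue (X n))"
    by (simp add: YX)
  also have "(\<Sum>n. emeasure lebesgue (X n)) = emeasure lebesgue (\<Union>n. X n)"
    using Xm dX by (intro suminf_emeasure) auto
  also have "ennreal (K ^ DIM('a)) * \<dots> \<le> ennreal (K ^ DIM('a)) * emeasure lebesgue U"
    using UX U(1) by (intro mult_left_mono emeasure_mono) auto
  also have "emeasure lebesgue U \<le> emeasure lebesgue B + emeasure lebesgue (U - B)"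
    using emeasure_subadditive[of B lebesgue "U - B"] B U by (simp add: Un_absorb1)
  also have "\<dots> \<le> emeasure lebesgue B + ennreal e" using U by (intro add_left_mono) auto
  finally have "emeasure lebesgue (\<phi> ` S) \<le> ennreal (K ^ DIM('a)) * (emeasure lebesgue B + ennreal e)"
    by (simp add: mult_left_mono)
  also have "\<dots> = ennreal (K ^ DIM('a)) * emeasure lebesgue B + ennreal e'"
    using K e by (simp add: distrib_left ennreal_mult'[symmetric] e_def)
  finally show "emeasure lebesgue (\<phi> ` S) \<le> ennreal (K ^ DIM('a)) * emeasure lebesgue B + ennreal e'" .
qed

lemma borel_measurable_vecI:
  fixes f :: "'a \<Rightarrow> real^'n"
  assumes "\<And>i. (\<lambda>x. f x $ i) \<in> borel_measurable M"
  shows "f \<in> borel_measurable M"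
  unfolding borel_measurable_euclidean_space[where f = f]
  using assms by (auto simp: Basis_vec_def inner_axis)

lemma diag_affine_image:
  fixes C t :: "real^'n"
  assumes C: "\<And>i. C $ i \<noteq> 0" and F: "F \<in> sets borel"
  defines "T \<equiv> (\<lambda>x. \<chi> i. t $ i + C $ i * x $ i) :: real^'n \<Rightarrow> real^'n"
  shows "T ` F \<in> sets borel" "emeasure lborel (T ` F) = ennreal (\<Prod>i\<in>UNIV. \<bar>C $ i\<bar>) * emeasure lborel F"
proof -
  define T' where "T' = (\<lambda>y :: real^'n. \<chi> i. (y $ i - t $ i) / C $ i)"
  have T'T: "T' (T x) = x" and TT': "T (T' x) = x" for x
    using C by (simp_all add: T'_def T_def vec_eq_iff)
  have [measurable]: "T' \<in> borel_measurable borel" "T \<in> borel_measurable borel"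
    unfolding T'_def T_def by (auto intro!: borel_measurable_vecI)
  have "T ` F = T' -` F"
  proof (intro equalityI subsetI)
    fix y assume "y \<in> T' -` F"
    then show "y \<in> T ` F" using TT'[of y] by (auto intro!: image_eqI[of _ _ "T' y"])
  qed (auto simp: T'T)
  then show TF: "T ` F \<in> sets borel"
    using measurable_sets[OF \<open>T' \<in> borel_measurable borel\<close> F] by simp
  have TTF: "T -` (T ` F) = F" using T'T by (auto simp: image_iff) metis
  have bas: "(\<Sum>j\<in>Basis. ((C \<bullet> j) * (x \<bullet> j)) *\<^sub>R j) = (\<chi> i. C $ i * x $ i)" for x
  proof -
    have "(\<Sum>j\<in>Basis. ((C \<bullet> j) * (x \<bullet> j)) *\<^sub>R j) = (\<Sum>j\<in>Basis. ((\<chi> i. C $ i * x $ i) \<bullet> j) *\<^sub>R j)"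
      by (intro sum.cong refl) (auto simp: Basis_vec_def inner_axis)
    then show ?thesis by (simp only: euclidean_representation)
  qed
  have T_eq: "T = (\<lambda>x. t + (\<Sum>j\<in>Basis. ((C \<bullet> j) * (x \<bullet> j)) *\<^sub>R j))"
    by (simp add: bas T_def fun_eq_iff vec_eq_iff)
  have prod_eq: "(\<Prod>j\<in>Basis. \<bar>C \<bullet> j\<bar>) = (\<Prod>i\<in>UNIV. \<bar>C $ i\<bar>)"
  proof -
    have B: "(Basis :: (real^'n) set) = (\<lambda>i. axis i 1) ` UNIV" by (auto simp: Basis_vec_def)
    have "inj (\<lambda>i. axis i 1 :: real^'n)" by (auto simp: inj_on_def axis_eq_axis)
    then show ?thesis unfolding B by (subst prod.reindex) (auto simp: inner_axis)
  qed
  have "(lborel :: (real^'n) measure) = density (distr lborel borel T) (\<lambda>_. \<Prod>j\<in>Basis. \<bar>C \<bullet> j\<bar>)"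
    unfolding T_eq by (rule lborel_affine_euclidean) (use C in \<open>auto simp: Basis_vec_def inner_axis\<close>)
  then have "emeasure lborel (T ` F) = emeasure (density (distr lborel borel T) (\<lambda>_. \<Prod>j\<in>Basis. \<bar>C \<bullet> j\<bar>)) (T ` F)"
    by simp
  also have "\<dots> = ennreal (\<Prod>i\<in>UNIV. \<bar>C $ i\<bar>) * emeasure (distr lborel borel T) (T ` F)"
    using TF by (simp add: emeasure_density prod_eq nn_integral_cmult_indicator)
  also have "emeasure (distr lborel borel T) (T ` F) = emeasure lborel F"
    using TF by (subst emeasure_distr) (simp_all add: TTF)
  finally show "emeasure lborel (T ` F) = ennreal (\<Prod>i\<in>UNIV. \<bar>C $ i\<bar>) * emeasure lborel F" .
qed

subsection \<open>Growth of heights along an orbit\<close>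

primrec tower :: "real \<Rightarrow> nat \<Rightarrow> real" where
  "tower lam 0 = 0"
| "tower lam (Suc k) = lam * exp (tower lam k)"

lemma tower_ge:
  assumes "lam > 1"
  shows "tower lam k \<ge> real k"
proof (induction k)
  case (Suc k)
  have "1 + real k \<le> exp (tower lam k)"
    using exp_ge_add_one_self[of "tower lam k"] Suc by linarith
  also have "\<dots> \<le> lam * exp (tower lam k)" using assms by simp
  finally show ?case by simp
qed simp

text \<open>The losses on an excursion are linear in its length. The linear bound
  \<open>tower_ge\<close>, put once through the exponential, beats any of them.\<close>

lemma eventually_tower_ge:
  assumes "lam > 1"
  shows "eventually (\<lambda>k. tower lam k \<ge> C * real k + C') sequentially"
proof -
  have "eventually (\<lambda>k::nat. exp (real k) \<ge> C * (real k + 1) + C') at_top" by real_asymp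
  then have "eventually (\<lambda>k. tower lam (Suc k) \<ge> C * real (Suc k) + C') sequentially"
  proof eventually_elim
    case (elim k)
    have "exp (real k) \<le> exp (tower lam k)" using tower_ge[OF assms, of k] by simp
    also have "\<dots> \<le> lam * exp (tower lam k)" using assms by simp
    finally show ?case using elim by (simp add: add.commute)
  qed
  then show ?thesis using eventually_sequentially_Suc[of "\<lambda>k. tower lam k \<ge> C * real k + C'"] by simp
qed

text \<open>In the application \<open>a n\<close> is the height of the \<open>n\<close>-th point of an orbit, and \<open>e m k\<close> is the distance
  of the point number \<open>m + 1 + k\<close> from the \<open>k\<close>-th point of the orbit of the origin, whose height is
  \<open>tower lam k\<close>. The assumptions are contradictory: a very low point is followed by a long excursion
  along the orbit of the origin, in which the sum of the heights more than recovers, and moderately low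
  points are paid for by the point before them.\<close>

locale heights =
  fixes lam :: real and a :: "nat \<Rightarrow> real" and e :: "nat \<Rightarrow> nat \<Rightarrow> real" and \<beta> :: real
  assumes lam: "lam > 2" and \<beta>: "\<beta> > 0"
    and abs_a_Suc: "\<And>n. \<bar>a (Suc n)\<bar> \<le> lam * exp (a n)"
    and e_0: "\<And>m. e m 0 = lam * exp (a m)"
    and e_height: "\<And>m k. \<bar>a (m + 1 + k) - tower lam k\<bar> \<le> e m k"
    and e_Suc: "\<And>m k. e m k \<le> 1 \<Longrightarrow> e m (Suc k) \<le> exp 1 * tower lam (Suc k) * e m k"
    and growth: "eventually (\<lambda>n. 3 * (\<Sum>i<n. a i) + 2 * \<beta> * n < ln (1 + (a n)\<^sup>2)) sequentially"
    and drop: "\<And>R \<eta>. \<eta> > 0 \<Longrightarrow> eventually (\<lambda>n. a (Suc n) < - \<eta> \<longrightarrow> a n > R) sequentially"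
begin

text \<open>The drift 2 \<beta> of \<open>growth\<close> is split: one half stays in
  \<open>V\<close> and covers, step by step, heights down to - \<beta> / 3; the other stays explicit
  in \<open>growth_V\<close> and gives the final contradiction.\<close>

definition V where "V n = 3 * (\<Sum>i<n. a i) + \<beta> * real n"

lemma V_Suc: "V (Suc n) = V n + 3 * a n + \<beta>"
  by (simp add: V_def algebra_simps)

lemma growth_V: "eventually (\<lambda>n. V n + \<beta> * real n < ln (1 + (a n)\<^sup>2)) sequentially"
  using growth by eventually_elim (simp add: V_def algebra_simps)

definition C0 where "C0 = ln (1 + lam\<^sup>2)"

text \<open>The right-hand side of \<open>growth_V\<close> at the next time costs only twice the
  present height, while \<open>V\<close> gains three times that height.\<close>

lemma ln_a_Suc: "ln (1 + (a (Suc n))\<^sup>2) \<le> 2 * max 0 (a n) + C0"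
proof -
  define p where "p = max 0 (a n)"
  have "\<bar>a (Suc n)\<bar> \<le> lam * exp p"
    by (rule order_trans[OF abs_a_Suc]) (use lam in \<open>auto simp: p_def\<close>)
  then have "(a (Suc n))\<^sup>2 \<le> (lam * exp p)\<^sup>2" using abs_le_square_iff[of "a (Suc n)" "lam * exp p"] lam by simp
  also have "\<dots> = lam\<^sup>2 * exp (2 * p)" by (simp add: power_mult_distrib exp_double)
  finally have "1 + (a (Suc n))\<^sup>2 \<le> 1 * exp (2 * p) + lam\<^sup>2 * exp (2 * p)"
    using one_le_exp_iff[of "2 * p"] by (intro add_mono) (auto simp: p_def)
  then have "ln (1 + (a (Suc n))\<^sup>2) \<le> ln (exp (2 * p) * (1 + lam\<^sup>2))"
    by (intro ln_mono) (auto simp: algebra_simps add_pos_nonneg)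
  also have "\<dots> = 2 * p + C0"
  proof -
    have "1 + lam\<^sup>2 \<noteq> 0" by (smt (verit) zero_le_power2)
    then show ?thesis by (simp add: C0_def ln_mult)
  qed
  finally show ?thesis by (simp add: p_def)
qed

text \<open>The factor in \<open>e_Suc\<close> is exp(1 + ln lam + tower lam k), so the logarithm of
  the error is bounded by the sum of the heights of the shadowed orbit. The same sum enters
  \<open>V\<close>: once the error exceeds 1, that sum has made up for \<open>a m\<close> up to a
  linear term.\<close>

lemma e_le_exp:
  assumes "\<And>i. i \<le> K \<Longrightarrow> e m i \<le> 1"
  shows "e m (Suc K) \<le> exp (real (K + 1) * (1 + ln lam) + ln lam + (\<Sum>i\<le>K. tower lam i) + a m)"
  using assms
proof (induction K)
  case 0
  have "e m (Suc 0) \<le> exp 1 * tower lam (Suc 0) * e m 0" using 0 by (intro e_Suc) auto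
  also have "\<dots> = exp (real (0 + 1) * (1 + ln lam) + ln lam + (\<Sum>i\<le>0. tower lam i) + a m)"
    using lam by (simp add: e_0 exp_add exp_double power2_eq_square)
  finally show ?case .
next
  case (Suc K)
  have "e m (Suc (Suc K)) \<le> exp 1 * tower lam (Suc (Suc K)) * e m (Suc K)" using Suc by (intro e_Suc) auto
  also have "\<dots> = exp (1 + ln lam + tower lam (Suc K)) * e m (Suc K)"
    using lam by (simp add: exp_add)
  also have "\<dots> \<le> exp (1 + ln lam + tower lam (Suc K)) *
      exp (real (K + 1) * (1 + ln lam) + ln lam + (\<Sum>i\<le>K. tower lam i) + a m)"
    using Suc by (intro mult_left_mono) auto
  also have "\<dots> = exp (real (Suc K + 1) * (1 + ln lam) + ln lam + (\<Sum>i\<le>Suc K. tower lam i) + a m)"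
    by (subst exp_add[symmetric]) (simp add: algebra_simps)
  finally show ?case .
qed

text \<open>Eternal shadowing would make the heights tend to infinity and keep \<open>V\<close>
  bounded below. Each step then adds 3 a_n to \<open>V\<close>, but \<open>growth_V\<close> and
  \<open>ln_a_Suc\<close> allow only 2 a_n plus a constant.\<close>

lemma excursion_ends: "\<exists>k. e m k > 1"
proof (rule ccontr)
  assume "\<not> ?thesis"
  then have e1: "e m k \<le> 1" for k by (simp add: not_less)
  have ak: "a (m + 1 + k) \<ge> real k - 1" for k
    using e_height[of m k] e1[of k] tower_ge[of lam k] lam by linarith
  have V: "V (m + 2 + k) \<ge> V (m + 2)" for k
  proof (induction k)
    case (Suc k)
    show ?case using Suc V_Suc[of "m + 2 + k"] ak[of "Suc k"] \<beta> by simp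
  qed simp
  obtain N where N: "\<And>n. n \<ge> N \<Longrightarrow> V n + \<beta> * real n < ln (1 + (a n)\<^sup>2)"
    using growth_V by (auto simp: eventually_sequentially)
  obtain k :: nat where k: "real k > C0 - V (m + 2) + real N" using reals_Archimedean2 by blast
  define n where "n = m + 2 + (k + N)"
  have "V (Suc n) + \<beta> * real (Suc n) < 2 * max 0 (a n) + C0"
    using N[of "Suc n"] ln_a_Suc[of n] by (simp add: n_def)
  moreover have an: "a n \<ge> real k"
    using ak[of "Suc (k + N)"] by (simp add: n_def)
  ultimately have "V n + 3 * a n + \<beta> + \<beta> * real (Suc n) < 2 * a n + C0"
    by (simp add: V_Suc)
  moreover have "\<beta> * real (Suc n) \<ge> 0" using \<beta> by simp
  ultimately show False using V[of "k + N", folded n_def] an k \<beta> by linarith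
qed

text \<open>The surplus \<open>2 * max 0 (a (i - 1))\<close> pays for a moderately low point at time \<open>i\<close>, and it also
  absorbs the right-hand side of \<open>growth_V\<close>, by \<open>ln_a_Suc\<close>.\<close>
definition clean where "clean W i \<longleftrightarrow> V i \<ge> W + 2 * max 0 (a (i - 1))"

text \<open>A height above - \<beta> / 3 is paid for by the drift, one down to - M by the surplus
  from the previous height above 2 M, and a lower one by the excursion that follows it.\<close>

lemma next_clean:
  "eventually (\<lambda>i. \<forall>W. clean W i \<longrightarrow> (\<exists>i'>i. clean W i')) sequentially"
proof -
  \<comment> \<open>Loss per step of an excursion: 1 + ln lam from \<open>e_le_exp\<close>, and 1
    because the orbit may lie below the tower by 1. The bound demanded of the tower below is 6 C1 (K
    + 2) + 2, so that half of it outweighs three times the loss (K + 2) C1.\<close>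
  define C1 where "C1 = 2 + ln lam"
  have lnlam: "ln lam > 0" using lam by simp
  have "eventually (\<lambda>K. tower lam K \<ge> 6 * C1 * real K + (12 * C1 + 2)) sequentially"
    using lam by (intro eventually_tower_ge) auto
  then obtain K0 where K0: "\<And>K. K \<ge> K0 \<Longrightarrow> tower lam K \<ge> 6 * C1 * real K + (12 * C1 + 2)"
    by (auto simp: eventually_sequentially)
  have tpos: "tower lam i \<ge> 0" for i using tower_ge[of lam i] lam by linarith
  \<comment> \<open>An excursion whose error first exceeds 1 at \<open>Suc K\<close> must have
    started at depth less than \<open>B K\<close>. A start below - \<open>B K0\<close> therefore
    lasts long enough for the tower bound to apply.\<close>
  define B where "B K = real (K + 2) * (1 + ln lam) + (\<Sum>i\<le>K. tower lam i)" for K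
  have Bmono: "B K \<le> B K'" if "K \<le> K'" for K K'
    unfolding B_def using that lnlam tpos
    by (intro add_mono mult_right_mono sum_mono2) auto
  define M where "M = B K0"
  have Mln: "M \<ge> ln lam"
  proof -
    have "ln lam \<le> real (K0 + 2) * (1 + ln lam)" using lnlam by (simp add: algebra_simps)
    then show ?thesis using sum_nonneg[of "{..K0}" "tower lam"] tpos by (simp add: M_def B_def)
  qed
  have "eventually (\<lambda>n. a (Suc n) < - (\<beta> / 3) \<longrightarrow> a n > 2 * M) sequentially" using \<beta> by (intro drop) auto
  then have "eventually (\<lambda>n. n \<ge> 1 \<and> (a n < - (\<beta> / 3) \<longrightarrow> a (n - 1) > 2 * M)) sequentially"
    by (subst eventually_sequentially_Suc[symmetric]) simp
  then show ?thesis
  proof eventually_elim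
    case (elim i)
    show ?case
    proof (intro allI impI)
      fix W assume cl: "clean W i"
      then have Vi: "V i \<ge> W" "V i \<ge> W + 2 * a (i - 1)" by (auto simp: clean_def max_def split: if_splits)
      consider "a i \<ge> - (\<beta> / 3)" | "a i < - (\<beta> / 3)" "a i \<ge> - M" | "a i < - M" by linarith
      then show "\<exists>i'>i. clean W i'"
      proof cases
        case 1
        then have "clean W (Suc i)" using Vi \<beta> by (auto simp: clean_def V_Suc max_def)
        then show ?thesis by blast
      next
        case 2
        then have "clean W (Suc i)" using Vi elim \<beta> Mln lnlam by (auto simp: clean_def V_Suc max_def)
        then show ?thesis by blast
      next
        case 3
        define P where "P k \<longleftrightarrow> e i k > 1" for k
        have "\<exists>k. P k" using excursion_ends by (simp add: P_def)
        moreover have "e i 0 \<le> exp (ln lam + a i)" using lam by (simp add: e_0 exp_add)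
        then have "e i 0 \<le> 1" using 3 Mln by (smt (verit) exp_le_one_iff)
        then have "\<not> P 0" by (simp add: P_def)
        ultimately obtain K where K: "P (Suc K)" "\<And>k. k \<le> K \<Longrightarrow> \<not> P k"
          using ex_least_nat_less[of P] by (metis less_Suc_eq_le)
        then have eK: "e i (Suc K) > 1" "\<And>k. k \<le> K \<Longrightarrow> e i k \<le> 1" by (auto simp: P_def not_less)
        define T where "T = (\<Sum>k\<le>K. tower lam k)"
        have lne: "ln (e i (Suc K)) \<le> real (K + 1) * (1 + ln lam) + ln lam + T + a i"
        proof -
          have "e i (Suc K) \<le> exp (real (K + 1) * (1 + ln lam) + ln lam + T + a i)"
            unfolding T_def by (rule e_le_exp) (rule eK(2))
          then have "ln (e i (Suc K)) \<le> ln (exp (real (K + 1) * (1 + ln lam) + ln lam + T + a i))"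
            using eK(1) by (intro ln_mono) auto
          then show ?thesis by simp
        qed
        have lne0: "ln (e i (Suc K)) > 0" using eK(1) by simp
        have "- a i < B K" using lne lne0 lnlam by (simp add: B_def T_def algebra_simps)
        then have "K0 \<le> K" using 3 Bmono[of K K0] by (cases "K \<le> K0") (auto simp: M_def)
        \<comment> \<open>Since the error is counted from the point after \<open>i\<close>, this is
          the first point with error above 1.\<close>
        define q where "q = i + K + 2"
        have "(\<Sum>k\<le>K. a (i + 1 + k)) \<ge> (\<Sum>k\<le>K. tower lam k - 1)"
          using e_height[of i] eK(2) by (intro sum_mono) (smt (verit) atMost_iff)
        then have sK: "(\<Sum>k\<le>K. a (i + 1 + k)) \<ge> T - real (K + 1)" by (simp add: sum_subtractf T_def)
        have "(\<Sum>j<i + 1 + n. a j) = (\<Sum>j<i. a j) + a i + (\<Sum>k<n. a (i + 1 + k))" for n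
          by (induction n) (simp_all add: algebra_simps)
        from this[of "Suc K"] have Sq: "(\<Sum>j<q. a j) = (\<Sum>j<i. a j) + a i + (\<Sum>k\<le>K. a (i + 1 + k))"
          by (simp add: q_def lessThan_Suc_atMost)
        have "(\<Sum>j<q. a j) \<ge> (\<Sum>j<i. a j) + ln (e i (Suc K)) - real (K + 2) * C1"
          using Sq sK lne lnlam by (simp add: C1_def algebra_simps)
        moreover have "\<beta> * real q \<ge> \<beta> * real i" using \<beta> by (simp add: q_def)
        ultimately have Vq: "V q \<ge> V i + 3 * ln (e i (Suc K)) - 3 * (real (K + 2) * C1)"
          unfolding V_def by linarith
        have tK: "tower lam K \<ge> 6 * C1 * real K + (12 * C1 + 2)"
          and tK': "tower lam (Suc K) \<ge> 6 * C1 * real (Suc K) + (12 * C1 + 2)"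
          using K0[of K] K0[of "Suc K"] \<open>K0 \<le> K\<close> by (auto simp del: tower.simps)
        have C1: "C1 > 0" using lnlam by (simp add: C1_def)
        have C1K: "real (K + 2) * C1 \<ge> 0" using C1 by simp
        show ?thesis
        \<comment> \<open>If the error is comparable to the tower, its logarithm is at least
          \<open>tower lam K\<close> and pays at time \<open>q\<close>. Otherwise the point
          \<open>q\<close> is itself still high and pays one step later.\<close>
        proof (cases "e i (Suc K) > tower lam (Suc K) / 2")
          case True
          have "tower lam K = ln (exp (tower lam K))" by simp
          also have "\<dots> \<le> ln (tower lam (Suc K) / 2)" using lam by (intro ln_mono) auto
          also have "\<dots> \<le> ln (e i (Suc K))" using True lam eK(1) by (intro ln_mono) auto
          finally have "V q \<ge> W + 3 * tower lam K - 3 * (real (K + 2) * C1)" using Vq Vi by linarith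
          moreover have "a (q - 1) \<le> tower lam K + 1"
            using e_height[of i K] eK(2)[of K] by (simp add: q_def)
          moreover have "tower lam K \<ge> 3 * (real (K + 2) * C1) + 2"
            using tK C1K by (simp add: algebra_simps)
          ultimately have "clean W q" using tpos[of K] C1K by (simp add: clean_def max_def)
          then show ?thesis by (intro exI[of _ q]) (simp add: q_def)
        next
          case False
          have q: "q = i + 1 + Suc K" by (simp add: q_def)
          have "a q \<ge> tower lam (Suc K) / 2"
            using e_height[of i "Suc K"] False unfolding q by linarith
          moreover have "tower lam (Suc K) / 2 \<ge> 3 * (real (K + 2) * C1)"
            using tK' C1 by (simp add: algebra_simps)
          ultimately have "clean W (Suc q)"
            using Vq Vi lne0 C1K \<beta> by (simp add: clean_def V_Suc max_def)
          then show ?thesis by (intro exI[of _ "Suc q"]) (simp add: q_def)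
        qed
      qed
    qed
  qed
qed

lemma inconsistent: False
proof -
  obtain N where N: "\<And>i W. i \<ge> N \<Longrightarrow> clean W i \<Longrightarrow> \<exists>i'>i. clean W i'"
    and G: "\<And>i. i \<ge> N \<Longrightarrow> V i + \<beta> * real i < ln (1 + (a i)\<^sup>2)"
    using eventually_conj[OF next_clean growth_V] by (auto simp: eventually_sequentially)
  \<comment> \<open>Makes \<open>Suc N\<close> clean, which starts an infinite sequence of clean
    times.\<close>
  define W where "W = V (Suc N) - 2 * max 0 (a N)"
  have "\<exists>i\<ge>Suc N + j. clean W i" for j
  proof (induction j)
    case 0
    show ?case by (intro exI[of _ "Suc N"]) (simp add: clean_def W_def)
  next
    case (Suc j)
    then obtain i where i: "i \<ge> Suc N + j" "clean W i" by blast
    then obtain i' where "i' > i" "clean W i'" using N[of i W] by auto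
    then show ?case using i by (intro exI[of _ i']) auto
  qed
  moreover obtain j :: nat where j: "real j > (C0 - W) / \<beta>" using reals_Archimedean2 by blast
  ultimately obtain i where i: "i \<ge> Suc N + j" "clean W i" by blast
  then have "V i + \<beta> * real i < 2 * max 0 (a (i - 1)) + C0"
    using G[of i] ln_a_Suc[of "i - 1"] by simp
  then have "W + \<beta> * real i < C0" using i by (simp add: clean_def)
  moreover have "\<beta> * real i \<ge> \<beta> * real j" using i \<beta> by (intro mult_left_mono) auto
  moreover have "\<beta> * real j > C0 - W" using j \<beta> by (simp add: field_simps)
  ultimately show False by linarith
qed

end

subsection \<open>Geometry of the Zorich map\<close>

lemma strip_idx_bounds:
  assumes "lam > 0"
  shows "2 * of_int (strip_idx lam t) * lam - lam \<le> t" "t < 2 * of_int (strip_idx lam t) * lam + lam"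
proof -
  have "of_int (strip_idx lam t) \<le> (t + lam) / (2 * lam)" "(t + lam) / (2 * lam) < of_int (strip_idx lam t) + 1"
    by (simp_all add: strip_idx_def)
  with assms show "2 * of_int (strip_idx lam t) * lam - lam \<le> t" "t < 2 * of_int (strip_idx lam t) * lam + lam"
    by (simp_all add: field_simps)
qed

lemma strip_idx_eqI:
  assumes "lam > 0" "2 * of_int m * lam - lam \<le> t" "t < 2 * of_int m * lam + lam"
  shows "strip_idx lam t = m"
  unfolding strip_idx_def using assms by (intro floor_unique) (simp_all add: field_simps)

lemma fold_coord_eq:
  "fold_coord lam t = (if even (strip_idx lam t) then 1 else -1) * (t - 2 * of_int (strip_idx lam t) * lam)"
  by (simp add: fold_coord_def Let_def)

lemma abs_fold_coord_le:
  assumes "lam > 0"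
  shows "\<bar>fold_coord lam t\<bar> \<le> lam"
  using strip_idx_bounds[OF assms, of t] by (auto simp: fold_coord_eq abs_if)

lemma fold_coord_id:
  assumes "\<bar>t\<bar> < lam"
  shows "strip_idx lam t = 0" "fold_coord lam t = t"
proof -
  show "strip_idx lam t = 0" using assms by (intro strip_idx_eqI) auto
  then show "fold_coord lam t = t" by (simp add: fold_coord_eq)
qed

lemma fold_coord_lipschitz:
  assumes lam: "lam > 0"
  shows "\<bar>fold_coord lam t - fold_coord lam t'\<bar> \<le> \<bar>t - t'\<bar>"
proof -
  have *: "\<bar>fold_coord lam t - fold_coord lam t'\<bar> \<le> t' - t" if "t \<le> t'" for t t'
  proof -
    define m where "m = strip_idx lam t"
    define m' where "m' = strip_idx lam t'"
    note b = strip_idx_bounds[OF lam, of t, folded m_def] strip_idx_bounds[OF lam, of t', folded m'_def]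
    have "m \<le> m'"
      unfolding m_def m'_def strip_idx_def using that lam by (intro floor_mono) (simp add: divide_right_mono)
    then consider "m' = m" | "m' = m + 1" | "m' \<ge> m + 2" by linarith
    then show ?thesis
    proof cases
      case 1
      then show ?thesis using that by (auto simp: fold_coord_eq m_def[symmetric] m'_def[symmetric] abs_if)
    next
      case 2
      then show ?thesis using b by (auto simp: fold_coord_eq m_def[symmetric] m'_def[symmetric] abs_if algebra_simps)
    next
      case 3
      then have "real_of_int m' * lam \<ge> (real_of_int m + 2) * lam"
        using lam by (intro mult_right_mono) auto
      then have "2 * lam \<le> t' - t" using b by (simp add: algebra_simps)
      then show ?thesis using abs_fold_coord_le[OF lam, of t] abs_fold_coord_le[OF lam, of t'] by linarith
    qed
  qed
  show ?thesis using *[of t t'] *[of t' t] by (cases "t \<le> t'") auto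
qed

lemma norm_vec3: "(norm (x::real^3))\<^sup>2 = (x$1)\<^sup>2 + (x$2)\<^sup>2 + (x$3)\<^sup>2"
  unfolding power2_norm_eq_inner by (simp add: inner_vec_def sum_3 power2_eq_square)

lemma norm_vec2: "(norm (x::real^2))\<^sup>2 = (x$1)\<^sup>2 + (x$2)\<^sup>2"
  unfolding power2_norm_eq_inner by (simp add: inner_vec_def sum_2 power2_eq_square)

locale zorich_map =
  fixes hh :: "real^2 \<Rightarrow> real^3" and L lam :: real
  assumes L1: "L \<ge> 1"
    and bilip: "\<And>a b. a \<in> sqQ \<Longrightarrow> b \<in> sqQ \<Longrightarrow> dist a b / L \<le> dist (hh a) (hh b)"
               "\<And>a b. a \<in> sqQ \<Longrightarrow> b \<in> sqQ \<Longrightarrow> dist (hh a) (hh b) \<le> L * dist a b"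
    and hemi: "\<And>a. a \<in> sqQ \<Longrightarrow> hh a \<in> upper_hemisphere"
    and bdry: "\<And>a. a \<in> sqQ_boundary \<Longrightarrow> hh a \<in> equator"
    and diag1: "\<And>t. -1 \<le> t \<Longrightarrow> t \<le> 1 \<Longrightarrow> hh (vector [t, t]) $ 1 = hh (vector [t, t]) $ 2"
    and diag2: "\<And>t. -1 \<le> t \<Longrightarrow> t \<le> 1 \<Longrightarrow> hh (vector [t, - t]) $ 1 = - (hh (vector [t, - t]) $ 2)"
    and lam5: "lam > L ^ 5" and lam2: "lam > 2 * L"
begin

abbreviation Z where "Z \<equiv> zorich hh lam 1"

definition base :: "real^3 \<Rightarrow> real^2" where
  "base x = vector [fold_coord lam (x$1) / lam, fold_coord lam (x$2) / lam]"

definition upper :: "real^3 \<Rightarrow> bool" where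
  "upper x \<longleftrightarrow> even (strip_idx lam (x$1) + strip_idx lam (x$2))"

lemma lam_gt: "lam > 2" "lam > 0" "lam \<ge> L" "lam > 1"
  using lam2 L1 by auto

lemma base_nth [simp]: "base x $ 1 = fold_coord lam (x$1) / lam" "base x $ 2 = fold_coord lam (x$2) / lam"
  by (simp_all add: base_def)

lemma base_in [simp]: "base x \<in> sqQ"
  using abs_fold_coord_le[of lam] lam_gt by (simp add: sqQ_def)

lemma norm_hh: "a \<in> sqQ \<Longrightarrow> norm (hh a) = 1" and hh3: "a \<in> sqQ \<Longrightarrow> hh a $ 3 \<ge> 0"
  using hemi by (auto simp: upper_hemisphere_def)

lemma Z_nth:
  "Z x $ 1 = exp (x$3) * lam * hh (base x) $ 1"
  "Z x $ 2 = exp (x$3) * lam * hh (base x) $ 2"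
  "Z x $ 3 = (if upper x then 1 else -1) * (exp (x$3) * lam * hh (base x) $ 3)"
  by (simp_all add: zorich_def Let_def base_def upper_def)

lemma norm_Z: "norm (Z x) = lam * exp (x$3)"
proof -
  have "(norm (Z x))\<^sup>2 = (exp (x$3) * lam)\<^sup>2 * (norm (hh (base x)))\<^sup>2"
    by (simp add: norm_vec3 Z_nth algebra_simps power_mult_distrib)
  then have "(norm (Z x))\<^sup>2 = (lam * exp (x$3))\<^sup>2" by (simp add: norm_hh mult.commute)
  then show ?thesis using lam_gt by (simp add: power2_eq_iff_nonneg)
qed

text \<open>For unit vectors p and q, |s p - t q|^2 = (s - t)^2 + s t |p - q|^2; a common reflection
  of the range changes nothing. Radial and tangential parts can thus be estimated
  separately.\<close>

lemma dist_Z: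
  assumes "upper x = upper y"
  shows "(dist (Z x) (Z y))\<^sup>2 = (lam * (exp (x$3) - exp (y$3)))\<^sup>2
     + lam\<^sup>2 * exp (x$3) * exp (y$3) * (dist (hh (base x)) (hh (base y)))\<^sup>2"
proof -
  define p where "p = hh (base x)"
  define q where "q = hh (base y)"
  define s t where "s = exp (x$3)" "t = exp (y$3)"
  have n: "(p$1)\<^sup>2 + (p$2)\<^sup>2 + (p$3)\<^sup>2 = 1" "(q$1)\<^sup>2 + (q$2)\<^sup>2 + (q$3)\<^sup>2 = 1"
    using norm_vec3[of p] norm_vec3[of q] by (simp_all add: p_def q_def norm_hh)
  have p3: "p$3^2 = 1 - (p$1)\<^sup>2 - (p$2)\<^sup>2" "q$3^2 = 1 - (q$1)\<^sup>2 - (q$2)\<^sup>2" using n by auto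
  have "(dist (Z x) (Z y))\<^sup>2 = (s*lam*p$1 - t*lam*q$1)\<^sup>2 + (s*lam*p$2 - t*lam*q$2)\<^sup>2 + (s*lam*p$3 - t*lam*q$3)\<^sup>2"
    unfolding dist_norm norm_vec3
    using assms by (cases "upper x") (simp_all add: Z_nth p_def q_def s_t_def power2_eq_square algebra_simps)
  also have "\<dots> = (lam * (s - t))\<^sup>2 + lam\<^sup>2 * s * t * ((p$1 - q$1)\<^sup>2 + (p$2 - q$2)\<^sup>2 + (p$3 - q$3)\<^sup>2)"
    using p3 by algebra
  also have "(p$1 - q$1)\<^sup>2 + (p$2 - q$2)\<^sup>2 + (p$3 - q$3)\<^sup>2 = (dist p q)\<^sup>2"
    by (simp add: dist_norm norm_vec3)
  finally show ?thesis by (simp add: p_def q_def s_t_def)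
qed

text \<open>The plane \<open>x$1 = x$2\<close> is invariant, and \<open>D\<close> is \<open>sqrt 2\<close> times the distance to it.\<close>
definition D :: "real^3 \<Rightarrow> real" where "D x = \<bar>x$1 - x$2\<bar>"

lemma D_nonneg: "D x \<ge> 0" by (simp add: D_def)

text \<open>\<open>base x\<close> is compared with its orthogonal projection to the diagonal, where
  the first two coordinates of \<open>hh\<close> agree. The factors sqrt 2 on both sides
  cancel.\<close>

lemma D_Z_le: "D (Z x) \<le> L * exp (x$3) * D x"
proof -
  define u where "u = base x"
  define v :: "real^2" where "v = vector [(u$1 + u$2) / 2, (u$1 + u$2) / 2]"
  have u: "u \<in> sqQ" by (simp add: u_def)
  have v: "v \<in> sqQ" using u by (auto simp: sqQ_def v_def abs_if split: if_splits)
  have hv: "hh v $ 1 = hh v $ 2"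
    unfolding v_def using u by (intro diag1) (auto simp: sqQ_def abs_if split: if_splits)
  have sq: "(a - b)\<^sup>2 \<le> 2 * (a\<^sup>2 + b\<^sup>2 + c\<^sup>2)" for a b c :: real
  proof -
    have "2 * (a\<^sup>2 + b\<^sup>2 + c\<^sup>2) - (a - b)\<^sup>2 = (a + b)\<^sup>2 + 2 * c\<^sup>2"
      by (simp add: power2_eq_square algebra_simps)
    then show ?thesis by (smt (verit) zero_le_power2)
  qed
  have uv: "(u$1 - u$2)\<^sup>2 = 2 * (dist u v)\<^sup>2"
    unfolding dist_norm norm_vec2 by (simp add: v_def power2_eq_square field_simps)
  have "(hh u $ 1 - hh u $ 2)\<^sup>2 \<le> 2 * (dist (hh u) (hh v))\<^sup>2"
    using sq[of "(hh u - hh v)$1" "(hh u - hh v)$2" "(hh u - hh v)$3"] hv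
    unfolding dist_norm norm_vec3 by simp
  also have "\<dots> \<le> 2 * (L * dist u v)\<^sup>2"
    using bilip(2)[OF u v] by (intro mult_left_mono power_mono) auto
  also have "\<dots> = (L * (u$1 - u$2))\<^sup>2" by (simp add: power_mult_distrib uv)
  finally have "(hh u $ 1 - hh u $ 2)\<^sup>2 \<le> (L * (u$1 - u$2))\<^sup>2" .
  then have "\<bar>hh u $ 1 - hh u $ 2\<bar> \<le> \<bar>L * (u$1 - u$2)\<bar>" by (simp add: abs_le_square_iff)
  also have "\<dots> = L / lam * \<bar>fold_coord lam (x$1) - fold_coord lam (x$2)\<bar>"
    using L1 lam_gt by (simp add: u_def abs_mult diff_divide_distrib[symmetric] abs_divide)
  also have "\<dots> \<le> L / lam * D x"
    unfolding D_def using L1 lam_gt by (intro mult_left_mono fold_coord_lipschitz) auto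
  finally have h: "\<bar>hh u $ 1 - hh u $ 2\<bar> \<le> L / lam * D x" .
  have "D (Z x) = exp (x$3) * lam * \<bar>hh u $ 1 - hh u $ 2\<bar>"
    using lam_gt by (simp add: D_def Z_nth u_def abs_mult flip: right_diff_distrib)
  also have "\<dots> \<le> exp (x$3) * lam * (L / lam * D x)"
    using h lam_gt by (intro mult_left_mono) auto
  finally show ?thesis using lam_gt by (simp add: field_simps)
qed

end

text \<open>The edge meant is the upper end of the strip containing t; parity decides which end of
  the folded range it becomes.\<close>

lemma fold_coord_near_edge:
  "\<bar>fold_coord lam t - (if even (strip_idx lam t) then lam else - lam)\<bar>
     = \<bar>(2 * of_int (strip_idx lam t) + 1) * lam - t\<bar>"
  by (auto simp: fold_coord_eq abs_if algebra_simps)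

lemma abs_exp_diff_le:
  fixes s t m :: real
  assumes "s \<le> m" "t \<le> m"
  shows "\<bar>exp s - exp t\<bar> \<le> exp m * \<bar>s - t\<bar>"
proof -
  have *: "exp s - exp t \<le> exp m * (s - t)" if "t \<le> s" "s \<le> m" for s t :: real
  proof -
    have "exp s * (1 + (t - s)) \<le> exp s * exp (t - s)"
      by (intro mult_left_mono exp_ge_add_one_self) auto
    then have "exp s - exp t \<le> exp s * (s - t)" by (simp add: exp_diff algebra_simps)
    also have "\<dots> \<le> exp m * (s - t)" using that by (intro mult_right_mono) auto
    finally show ?thesis .
  qed
  show ?thesis
    using *[of t s] *[of s t] assms by (cases "t \<le> s") (auto simp: abs_if)
qed

context zorich_map begin

text \<open>A negative value requires strip indices of different parity. Then a face of the beams
  separates the two coordinates, \<open>base x\<close> is within D x / lam of the boundary of the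
  square, and \<open>hh\<close> has height 0 there.\<close>

lemma Z3_ge: "(Z x)$3 \<ge> - (L * exp (x$3) * D x)"
proof (cases "upper x")
  case True
  then show ?thesis
    using L1 lam_gt hh3[OF base_in[of x]] D_nonneg[of x] by (smt (verit) exp_ge_zero mult_nonneg_nonneg Z_nth(3))
next
  case False
  define n1 where "n1 = strip_idx lam (x$1)"
  define n2 where "n2 = strip_idx lam (x$2)"
  have "n1 \<noteq> n2" using False by (auto simp: upper_def n1_def n2_def)
  note b = strip_idx_bounds[OF lam_gt(2), of "x$1", folded n1_def]
           strip_idx_bounds[OF lam_gt(2), of "x$2", folded n2_def]
  have mono: "(2 * of_int m + 1) * lam \<le> 2 * of_int m' * lam - lam" if "m < m'" for m m' :: int
  proof -
    have "(of_int m + 1) * lam \<le> of_int m' * lam" using that lam_gt by (intro mult_right_mono) linarith+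
    then show ?thesis by (simp add: algebra_simps)
  qed
  have sc: "\<bar>a / lam - 1\<bar> = \<bar>a - lam\<bar> / lam" "\<bar>a / lam + 1\<bar> = \<bar>a + lam\<bar> / lam" for a
    using lam_gt abs_divide[of "a - lam" lam] abs_divide[of "a + lam" lam]
    by (simp_all add: diff_divide_distrib add_divide_distrib)
  have "\<exists>v\<in>sqQ_boundary. dist (base x) v \<le> D x / lam"
  proof (cases "n1 < n2")
    case True
    \<comment> \<open>The coordinate in the lower strip moves to the upper end of its strip, which
      lies between the two coordinates.\<close>
    define v :: "real^2" where "v = vector [if even n1 then 1 else -1, base x $ 2]"
    have vb: "v \<in> sqQ_boundary"
      using base_in[of x] by (auto simp: v_def sqQ_boundary_def sqQ_def)
    have "(dist (base x) v)\<^sup>2 = (base x $ 1 - v $ 1)\<^sup>2"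
      unfolding dist_norm norm_vec2 by (simp add: v_def)
    then have "dist (base x) v = \<bar>base x $ 1 - v $ 1\<bar>"
      by (metis abs_of_nonneg power2_abs power2_eq_iff_nonneg abs_ge_zero zero_le_dist)
    also have "\<dots> = \<bar>fold_coord lam (x$1) - (if even n1 then lam else - lam)\<bar> / lam"
      using sc lam_gt by (simp add: v_def)
    also have "\<dots> \<le> D x / lam"
      using b mono[OF True] lam_gt unfolding n1_def fold_coord_near_edge
      by (intro divide_right_mono) (auto simp: D_def n1_def abs_if distrib_right)
    finally show ?thesis using vb by auto
  next
    case False
    then have less: "n2 < n1" using \<open>n1 \<noteq> n2\<close> by simp
    define v :: "real^2" where "v = vector [base x $ 1, if even n2 then 1 else -1]"
    have vb: "v \<in> sqQ_boundary"
      using base_in[of x] by (auto simp: v_def sqQ_boundary_def sqQ_def)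
    have "(dist (base x) v)\<^sup>2 = (base x $ 2 - v $ 2)\<^sup>2"
      unfolding dist_norm norm_vec2 by (simp add: v_def)
    then have "dist (base x) v = \<bar>base x $ 2 - v $ 2\<bar>"
      by (metis abs_of_nonneg power2_abs power2_eq_iff_nonneg abs_ge_zero zero_le_dist)
    also have "\<dots> = \<bar>fold_coord lam (x$2) - (if even n2 then lam else - lam)\<bar> / lam"
      using sc lam_gt by (simp add: v_def)
    also have "\<dots> \<le> D x / lam"
      using b mono[OF less] lam_gt unfolding n2_def fold_coord_near_edge
      by (intro divide_right_mono) (auto simp: D_def n2_def abs_if distrib_right)
    finally show ?thesis using vb by auto
  qed
  then obtain v where v: "v \<in> sqQ_boundary" "dist (base x) v \<le> D x / lam" by blast
  have "v \<in> sqQ" "hh v $ 3 = 0" using v bdry[of v] by (auto simp: sqQ_boundary_def equator_def)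
  then have "\<bar>hh (base x) $ 3\<bar> \<le> dist (hh (base x)) (hh v)"
    using component_le_norm_cart[of "hh (base x) - hh v" 3] by (simp add: dist_norm)
  also have "\<dots> \<le> L * (D x / lam)"
    using bilip(2)[OF base_in \<open>v \<in> sqQ\<close>, of x] v L1 by (smt (verit) mult_left_mono)
  finally have "exp (x$3) * lam * hh (base x) $ 3 \<le> exp (x$3) * lam * (L * (D x / lam))"
    using lam_gt by (intro mult_left_mono) auto
  then show ?thesis using lam_gt False by (simp add: Z_nth field_simps)
qed

section \<open>Shadowing the orbit of the origin along the vertical axis\<close>

definition axis_pt :: "real \<Rightarrow> real^3" where "axis_pt E = vector [0, 0, E]"

lemma axis_pt_nth [simp]: "axis_pt E $ 1 = 0" "axis_pt E $ 2 = 0" "axis_pt E $ 3 = E"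
  by (simp_all add: axis_pt_def)

lemma Z_axis_pt: "Z (axis_pt E) = axis_pt (lam * exp E)"
proof -
  have b: "base (axis_pt E) = vector [0, 0]" "upper (axis_pt E)"
    using lam_gt fold_coord_id[of 0 lam] by (simp_all add: base_def upper_def)
  have "hh (vector [0, 0]) $ 1 = 0" "hh (vector [0, 0]) $ 2 = 0"
    using diag1[of 0] diag2[of 0] by auto
  moreover have "norm (hh (vector [0,0])) = 1" "hh (vector [0,0]) $ 3 \<ge> 0"
    using norm_hh[OF base_in, of "axis_pt E"] hh3[OF base_in, of "axis_pt E"] unfolding b by auto
  ultimately have "hh (vector [0, 0]) $ 3 = 1"
    using norm_vec3[of "hh (vector [0, 0])"] by (simp add: power2_eq_1_iff)
  then show ?thesis
    using \<open>hh (vector [0, 0]) $ 1 = 0\<close> \<open>hh (vector [0, 0]) $ 2 = 0\<close>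
    by (subst vec_eq_iff) (simp add: forall_3 Z_nth b)
qed

text \<open>Within distance 1 of the axis nothing is folded. As L is at most lam, \<open>hh\<close>
  moves by no more than the horizontal displacement, so both parts of \<open>dist_Z\<close> obey the
  same bound.\<close>

lemma dist_Z_axis_pt_le:
  assumes "dist x (axis_pt E) \<le> 1"
  shows "dist (Z x) (axis_pt (lam * exp E)) \<le> lam * exp (E + 1) * dist x (axis_pt E)"
proof -
  let ?p = "axis_pt E"
  have c: "\<bar>x$1\<bar> \<le> 1" "\<bar>x$2\<bar> \<le> 1" "\<bar>x$3 - E\<bar> \<le> 1"
    using assms component_le_norm_cart[of "x - ?p" 1] component_le_norm_cart[of "x - ?p" 2]
      component_le_norm_cart[of "x - ?p" 3] by (auto simp: dist_norm)
  have x: "upper x" "base x = vector [x$1 / lam, x$2 / lam]"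
    using c lam_gt fold_coord_id[of "x$1" lam] fold_coord_id[of "x$2" lam]
    by (simp_all add: base_def upper_def)
  have p: "upper ?p" "base ?p = 0"
    using lam_gt fold_coord_id[of 0 lam] by (simp_all add: base_def upper_def vec_eq_iff forall_2)
  define m where "m = exp (E + 1)"
  have dp: "(dist x ?p)\<^sup>2 = (x$1)\<^sup>2 + (x$2)\<^sup>2 + (x$3 - E)\<^sup>2"
    unfolding dist_norm norm_vec3 by simp
  have "(dist (hh (base x)) (hh (base ?p)))\<^sup>2 \<le> (L * dist (base x) (base ?p))\<^sup>2"
    by (intro power_mono bilip(2)) auto
  also have "\<dots> \<le> (lam * dist (base x) (base ?p))\<^sup>2"
    using L1 lam_gt by (intro power_mono mult_right_mono) auto
  also have "\<dots> = (x$1)\<^sup>2 + (x$2)\<^sup>2"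
    unfolding power_mult_distrib dist_norm norm_vec2 using lam_gt
    by (simp add: x p power_divide field_simps)
  finally have h: "(dist (hh (base x)) (hh (base ?p)))\<^sup>2 \<le> (x$1)\<^sup>2 + (x$2)\<^sup>2" .
  have e: "\<bar>exp (x$3) - exp E\<bar> \<le> m * \<bar>x$3 - E\<bar>"
    unfolding m_def using c by (intro abs_exp_diff_le) auto
  have ex: "exp (x$3) * exp E \<le> m * m"
    unfolding m_def using c by (intro mult_mono) auto
  have "(dist (Z x) (Z ?p))\<^sup>2 = lam\<^sup>2 * (exp (x$3) - exp E)\<^sup>2
     + lam\<^sup>2 * (exp (x$3) * exp E * (dist (hh (base x)) (hh (base ?p)))\<^sup>2)"
    by (subst dist_Z) (simp_all add: x p power_mult_distrib mult.assoc)
  also have "\<dots> \<le> lam\<^sup>2 * (m * \<bar>x$3 - E\<bar>)\<^sup>2 + lam\<^sup>2 * (m * m * ((x$1)\<^sup>2 + (x$2)\<^sup>2))"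
    using power_mono[OF e, of 2] mult_mono[OF ex h]
    by (intro add_mono mult_left_mono) (auto simp: m_def)
  also have "\<dots> = (lam * m * dist x ?p)\<^sup>2"
    unfolding power_mult_distrib dp power2_abs by algebra
  finally have "dist (Z x) (Z ?p) \<le> lam * m * dist x ?p"
    by (rule power2_le_imp_le) (use lam_gt in \<open>simp add: m_def\<close>)
  then show ?thesis by (simp add: Z_axis_pt m_def)
qed


text \<open>The cube gives D the same factor exp(3 x3) as the volume; the heights cancel and \<rho>
  / L^3 remains per step.\<close>

lemma D_orbit:
  assumes "\<rho> > 0"
  shows "(\<rho> / L^3)^n * D ((Z ^^ n) x)^3 \<le> (\<Prod>i<n. \<rho> * exp (3 * (Z ^^ i) x $ 3)) * D x ^ 3"
proof (induction n)
  case (Suc n)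
  define y where "y = (Z ^^ n) x"
  have "D (Z y) ^ 3 \<le> (L * exp (y$3) * D y)^3"
    using D_Z_le D_nonneg by (intro power_mono) auto
  then have "(\<rho> / L^3)^Suc n * D (Z y)^3 \<le> (\<rho> / L^3)^Suc n * (L * exp (y$3) * D y)^3"
    using assms L1 by (intro mult_left_mono) auto
  also have "\<dots> = \<rho> * exp (3 * y$3) * ((\<rho> / L^3)^n * D y^3)"
    using L1 by (simp add: power_mult_distrib exp_of_nat_mult[of 3, simplified] field_simps)
  also have "\<dots> \<le> \<rho> * exp (3 * y$3) * ((\<Prod>i<n. \<rho> * exp (3 * (Z ^^ i) x $ 3)) * D x ^ 3)"
    using Suc assms by (intro mult_left_mono) (auto simp: y_def)
  finally show ?case by (simp add: y_def mult_ac)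
qed simp

lemma orbit_growth_impossible:
  assumes D0: "D x > 0" and \<theta>: "\<theta> > 1" and \<rho>: "\<theta> < \<rho> / L^3"
    and ev: "eventually (\<lambda>n. (\<Prod>i<n. \<rho> * exp (3 * (Z ^^ i) x $ 3)) < \<theta>^n * (1 + ((Z ^^ n) x $ 3)\<^sup>2)) sequentially"
  shows False
proof -
  define a where "a n = (Z ^^ n) x $ 3" for n
  define e where "e m k = dist ((Z ^^ (m + 1 + k)) x) (axis_pt (tower lam k))" for m k
  have L3: "L^3 \<ge> 1" using L1 by simp
  have "\<theta> * L^3 < \<rho>" using \<rho> L1 by (simp add: pos_less_divide_eq)
  moreover have "\<theta> * L^3 \<ge> \<theta> * 1" using L3 \<theta> by (intro mult_left_mono) auto
  ultimately have \<rho>': "\<rho> > \<theta>" "\<rho> > 0" using \<theta> by linarith+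
  have aS: "a (Suc n) = Z ((Z ^^ n) x) $ 3" for n by (simp add: a_def)
  have abs_a: "\<bar>a (Suc n)\<bar> \<le> lam * exp (a n)" for n
    unfolding aS using component_le_norm_cart[of "Z ((Z ^^ n) x)" 3] by (simp add: norm_Z a_def)
  have J: "(\<Prod>i<n. \<rho> * exp (3 * (Z ^^ i) x $ 3)) = exp (n * ln \<rho> + 3 * (\<Sum>i<n. a i))" for n
  proof -
    have "(\<Prod>i<n. \<rho> * exp (3 * (Z ^^ i) x $ 3)) = (\<Prod>i<n. exp (ln \<rho> + 3 * a i))"
      using \<rho>' by (simp add: exp_add a_def)
    also have "\<dots> = exp (\<Sum>i<n. ln \<rho> + 3 * a i)" by (simp add: exp_sum)
    finally show ?thesis by (simp add: sum.distrib sum_distrib_left)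
  qed
  have "heights lam a e ((ln \<rho> - ln \<theta>) / 2)"
  proof
    show "lam > 2" "(ln \<rho> - ln \<theta>) / 2 > 0" using lam_gt \<rho>' \<theta> by auto
    show "\<bar>a (Suc n)\<bar> \<le> lam * exp (a n)" for n by (rule abs_a)
    \<comment> \<open>Shadowing starts at the image of point m, whose distance to the origin is its
      norm.\<close>
    have "axis_pt 0 = 0" by (simp add: vec_eq_iff forall_3)
    then show "e m 0 = lam * exp (a m)" for m
      by (simp add: e_def a_def norm_Z)
    show "\<bar>a (m + 1 + k) - tower lam k\<bar> \<le> e m k" for m k
      using component_le_norm_cart[of "(Z ^^ (m + 1 + k)) x - axis_pt (tower lam k)" 3]
      by (simp add: a_def e_def dist_norm)
    show "e m (Suc k) \<le> exp 1 * tower lam (Suc k) * e m k" if "e m k \<le> 1" for m k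
      using dist_Z_axis_pt_le[of "(Z ^^ (m + 1 + k)) x" "tower lam k"] that
      by (simp add: e_def exp_add mult_ac)
    show "eventually (\<lambda>n. 3 * (\<Sum>i<n. a i) + 2 * ((ln \<rho> - ln \<theta>) / 2) * n < ln (1 + (a n)\<^sup>2)) sequentially"
      using ev
    proof eventually_elim
      case (elim n)
      have p: "1 + (a n)\<^sup>2 > 0" by (smt (verit) zero_le_power2)
      have "exp (n * ln \<rho> + 3 * (\<Sum>i<n. a i)) < \<theta>^n * (1 + (a n)\<^sup>2)"
        using elim unfolding J by (simp add: a_def)
      also have "\<dots> = exp (n * ln \<theta> + ln (1 + (a n)\<^sup>2))"
        using p \<theta> by (simp add: exp_add exp_of_nat_mult)
      finally show ?case by (simp add: field_simps)
    qed
    fix R \<eta> :: real assume \<eta>: "\<eta> > 0"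
    \<comment> \<open>A point lower than - R' has an image too close to the origin to lie below -
      \<eta>. So the height is bounded on both sides, D decays like the cube root of r^n, and
      \<open>Z3_ge\<close> applies.\<close>
    define R' where "R' = max 0 (ln (lam / \<eta>))"
    define Q where "Q = max \<bar>R\<bar> R'"
    define r where "r = \<theta> * L^3 / \<rho>"
    have r: "0 < r" "r < 1" using \<theta> L1 \<rho>' \<open>\<theta> * L^3 < \<rho>\<close> by (auto simp: r_def)
    have "(\<lambda>n. r^n) \<longlonglongrightarrow> 0" using r by (intro LIMSEQ_power_zero) auto
    then have "(\<lambda>n. (L * exp R)^3 * (D x ^ 3 * (1 + Q\<^sup>2)) * r^n) \<longlonglongrightarrow> (L * exp R)^3 * (D x ^ 3 * (1 + Q\<^sup>2)) * 0"
      by (rule tendsto_mult_left)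
    then have "eventually (\<lambda>n. (L * exp R)^3 * (D x ^ 3 * (1 + Q\<^sup>2)) * r^n < \<eta>^3) sequentially"
      using \<eta> by (intro order_tendstoD(2)[where y = 0]) auto
    with ev show "eventually (\<lambda>n. a (Suc n) < - \<eta> \<longrightarrow> a n > R) sequentially"
    proof eventually_elim
      case (elim n)
      show ?case
      proof (intro impI, rule ccontr)
        assume neg: "a (Suc n) < - \<eta>" and "\<not> a n > R"
        then have aR: "a n \<le> R" by simp
        define y where "y = (Z ^^ n) x"
        have "\<eta> < lam * exp (a n)" using neg abs_a[of n] by linarith
        then have "ln (\<eta> / lam) < ln (exp (a n))"
          using \<eta> lam_gt by (intro ln_less_cancel_iff[THEN iffD2]) (auto simp: field_simps)
        then have "a n \<ge> - R'" using \<eta> lam_gt by (simp add: R'_def ln_div)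
        then have "\<bar>a n\<bar> \<le> \<bar>Q\<bar>" using aR by (auto simp: Q_def)
        then have aQ: "(a n)\<^sup>2 \<le> Q\<^sup>2" by (simp add: abs_le_square_iff)
        have "(\<rho> / L^3)^n * D y ^ 3 \<le> \<theta>^n * (1 + (a n)\<^sup>2) * D x ^ 3"
          unfolding y_def
          by (rule order_trans[OF D_orbit[OF \<rho>'(2)] mult_right_mono])
             (use elim(1) D_nonneg[of x] in \<open>auto simp: a_def\<close>)
        also have "\<dots> \<le> \<theta>^n * (1 + Q\<^sup>2) * D x ^ 3"
          using aQ \<theta> D0 by (intro mult_right_mono mult_left_mono) auto
        finally have "D y ^ 3 \<le> D x ^ 3 * (1 + Q\<^sup>2) * r^n"
          using \<rho>' L1 by (simp add: r_def power_divide power_mult_distrib field_simps)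
        then have "(L * exp R)^3 * D y ^ 3 \<le> (L * exp R)^3 * (D x ^ 3 * (1 + Q\<^sup>2) * r^n)"
          using L1 by (intro mult_left_mono) auto
        then have "(L * exp R * D y)^3 < \<eta>^3" using elim(2) by (simp add: power_mult_distrib mult_ac)
        then have "L * exp R * D y < \<eta>" using \<eta> by (rule power_less_imp_less_base[OF _ less_imp_le])
        moreover have "L * exp (y$3) * D y \<le> L * exp R * D y"
          using aR L1 D_nonneg by (intro mult_right_mono mult_left_mono) (auto simp: a_def y_def)
        ultimately show False using Z3_ge[of y] neg by (simp add: aS y_def)
      qed
    qed
  qed
  then show False by (rule heights.inconsistent)
qed

end

subsection \<open>Volume expansion\<close>

lemma exp_min_le_abs_exp_diff:
  fixes s t m :: real
  assumes "m \<le> s" "m \<le> t"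
  shows "exp m * \<bar>s - t\<bar> \<le> \<bar>exp s - exp t\<bar>"
proof -
  have *: "exp m * (s - t) \<le> exp s - exp t" if "t \<le> s" "m \<le> t" for s t :: real
  proof -
    have "exp m * (s - t) \<le> exp t * (s - t)" using that by (intro mult_right_mono) auto
    also have "exp t * (1 + (s - t)) \<le> exp t * exp (s - t)"
      by (intro mult_left_mono exp_ge_add_one_self) auto
    then have "exp t * (s - t) \<le> exp s - exp t" by (simp add: exp_diff algebra_simps)
    finally show ?thesis .
  qed
  show ?thesis using *[of t s] *[of s t] assms by (cases "t \<le> s") (auto simp: abs_if)
qed

lemma measurable_strip_idx [measurable]: "strip_idx lam \<in> borel \<rightarrow>\<^sub>M count_space UNIV"
  unfolding strip_idx_def[abs_def] by measurable

lemma borel_measurable_fold_coord [measurable]: "fold_coord lam \<in> borel_measurable borel"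
  unfolding fold_coord_eq[abs_def] by measurable

context zorich_map begin

section \<open>Measurability of the map\<close>

lemma closed_sqQ: "closed sqQ"
proof -
  have "sqQ = {a. \<bar>a$1\<bar> \<le> 1} \<inter> {a. \<bar>a$2\<bar> \<le> 1}" by (auto simp: sqQ_def)
  moreover have "closed ({a :: real^2. \<bar>a$1\<bar> \<le> 1} \<inter> {a. \<bar>a$2\<bar> \<le> 1})"
    by (intro closed_Int closed_Collect_le continuous_intros)
  ultimately show ?thesis by simp
qed

lemma continuous_on_hh: "continuous_on sqQ hh"
  using L1 bilip(2) by (intro lipschitz_on_continuous_on[of L]) (auto simp: lipschitz_on_def)

lemma borel_measurable_base [measurable]: "base \<in> borel_measurable borel"
proof (rule borel_measurable_vecI)
  fix i :: 2
  show "(\<lambda>x. base x $ i) \<in> borel_measurable borel"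
    using exhaust_2[of i] by (elim disjE) simp_all
qed

lemma measurable_upper [measurable]: "Measurable.pred borel upper"
  unfolding upper_def[abs_def] by measurable

lemma borel_measurable_hh_base: "(\<lambda>x. hh (base x)) \<in> borel_measurable borel"
proof -
  have [measurable]: "(\<lambda>v. indicator sqQ v *\<^sub>R hh v) \<in> borel_measurable borel"
    by (intro borel_measurable_continuous_on_indicator continuous_on_hh borel_closed closed_sqQ)
  have "(\<lambda>x. indicator sqQ (base x) *\<^sub>R hh (base x)) \<in> borel_measurable borel" by measurable
  then show ?thesis by simp
qed

lemma borel_measurable_Z [measurable]: "Z \<in> borel_measurable borel"
proof (rule borel_measurable_vecI)
  fix i :: 3
  have [measurable]: "(\<lambda>x. hh (base x) $ j) \<in> borel_measurable borel" for j
    by (rule measurable_compose[OF borel_measurable_hh_base borel_measurable_nth])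
  show "(\<lambda>x. Z x $ i) \<in> borel_measurable borel"
    using exhaust_3[of i] by (elim disjE) (simp_all add: Z_nth)
qed

lemma borel_measurable_Z_funpow [measurable]: "(\<lambda>x. (Z ^^ n) x) \<in> borel_measurable borel"
  by (induction n) (auto intro: measurable_compose[OF _ borel_measurable_Z])

text \<open>The scaling makes the inverse of \<open>Z\<close> Lipschitz with respect to \<open>\<phi>\<close> with the constant that
  yields the sharp volume bound: the radial direction expands by \<open>lam\<close>, the others by at least \<open>1 / L\<close>.\<close>
definition \<phi> :: "real^3 \<Rightarrow> real^3" where
  "\<phi> x = vector [fold_coord lam (x$1) / L, fold_coord lam (x$2) / L, lam * x$3]"

text \<open>With both heights at least m, the radial and the tangential term of
  \<open>dist_Z\<close> each dominate exp(2 m) times the corresponding term for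
  \<open>\<phi>\<close>.\<close>

lemma dist_\<phi>_le:
  fixes x y :: "real^3"
  assumes "upper x = upper y" "m \<le> x$3" "m \<le> y$3"
  shows "dist (\<phi> x) (\<phi> y) \<le> exp (- m) * dist (Z x) (Z y)"
proof -
  define d where "d = dist (base x) (base y)"
  have dp: "(dist (\<phi> x) (\<phi> y))\<^sup>2 = lam\<^sup>2 * (d / L)\<^sup>2 + lam\<^sup>2 * (x$3 - y$3)\<^sup>2"
  proof -
    have "d\<^sup>2 = ((fold_coord lam (x$1) - fold_coord lam (y$1))\<^sup>2 + (fold_coord lam (x$2) - fold_coord lam (y$2))\<^sup>2) / lam\<^sup>2"
      unfolding d_def dist_norm norm_vec2
      by (simp add: diff_divide_distrib[symmetric] power_divide add_divide_distrib)
    then show ?thesis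
      unfolding dist_norm norm_vec3 using lam_gt
      by (simp add: \<phi>_def diff_divide_distrib[symmetric] right_diff_distrib[symmetric] power_divide add_divide_distrib power_mult_distrib)
        (simp add: field_simps)
  qed
  have "(exp m * \<bar>x$3 - y$3\<bar>)\<^sup>2 \<le> \<bar>exp (x$3) - exp (y$3)\<bar>\<^sup>2"
    using assms by (intro power_mono exp_min_le_abs_exp_diff) auto
  then have 1: "(exp m)\<^sup>2 * (x$3 - y$3)\<^sup>2 \<le> (exp (x$3) - exp (y$3))\<^sup>2" by (simp add: power_mult_distrib)
  have "exp m * exp m * (d / L)\<^sup>2 \<le> exp (x$3) * exp (y$3) * (dist (hh (base x)) (hh (base y)))\<^sup>2"
    using assms bilip(1)[OF base_in base_in, of x y] L1
    by (intro mult_mono power_mono) (auto simp: d_def)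
  then have 2: "(exp m)\<^sup>2 * (d / L)\<^sup>2 \<le> exp (x$3) * exp (y$3) * (dist (hh (base x)) (hh (base y)))\<^sup>2"
    by (simp only: power2_eq_square)
  have "(exp m * dist (\<phi> x) (\<phi> y))\<^sup>2 = lam\<^sup>2 * ((exp m)\<^sup>2 * (x$3 - y$3)\<^sup>2) + lam\<^sup>2 * ((exp m)\<^sup>2 * (d / L)\<^sup>2)"
    by (simp only: power_mult_distrib dp distrib_left mult_ac add_ac)
  also have "\<dots> \<le> lam\<^sup>2 * (exp (x$3) - exp (y$3))\<^sup>2 + lam\<^sup>2 * (exp (x$3) * exp (y$3) * (dist (hh (base x)) (hh (base y)))\<^sup>2)"
    by (intro add_mono mult_left_mono 1 2) auto
  also have "\<dots> = (dist (Z x) (Z y))\<^sup>2"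
    by (simp only: dist_Z[OF assms(1)] power_mult_distrib mult.assoc)
  finally have "exp m * dist (\<phi> x) (\<phi> y) \<le> dist (Z x) (Z y)"
    by (rule power2_le_imp_le) simp
  then show ?thesis by (simp add: exp_minus field_simps)
qed

text \<open>On each product of strips \<open>\<phi>\<close> is affine with determinant of modulus
  lam / L^2; injectivity lets the countably many pieces be summed.\<close>

lemma \<phi>_image:
  assumes F: "F \<in> sets borel" and inj: "inj_on \<phi> F"
  shows "\<phi> ` F \<in> sets borel" "emeasure lborel (\<phi> ` F) = ennreal (lam / L\<^sup>2) * emeasure lborel F"
proof -
  define idx where "idx x = to_nat (strip_idx lam (x$1), strip_idx lam (x$2))" for x :: "real^3"
  have [measurable]: "idx \<in> borel \<rightarrow>\<^sub>M count_space UNIV"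
    unfolding idx_def[abs_def] by measurable
  define A where "A n = F \<inter> {x. idx x = n}" for n
  have A[measurable]: "A n \<in> sets borel" for n
    unfolding A_def using F by measurable
  have *: "\<phi> ` A n \<in> sets borel \<and> emeasure lborel (\<phi> ` A n) = ennreal (lam / L\<^sup>2) * emeasure lborel (A n)" for n
  proof -
    define p where "p = (from_nat n :: int \<times> int)"
    define \<sigma> where "\<sigma> m = (if even m then 1 else - 1 :: real)" for m :: int
    define C :: "real^3" where "C = vector [\<sigma> (fst p) / L, \<sigma> (snd p) / L, lam]"
    define t :: "real^3" where
      "t = vector [- \<sigma> (fst p) * 2 * of_int (fst p) * lam / L, - \<sigma> (snd p) * 2 * of_int (snd p) * lam / L, 0]"
    have "(strip_idx lam (x$1), strip_idx lam (x$2)) = p" if "x \<in> A n" for x :: "real^3"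
    proof -
      have "to_nat (strip_idx lam (x$1), strip_idx lam (x$2)) = n" using that by (simp add: A_def idx_def)
      then show ?thesis unfolding p_def by (metis from_nat_to_nat)
    qed
    then have idx: "strip_idx lam (x$1) = fst p" "strip_idx lam (x$2) = snd p" if "x \<in> A n" for x :: "real^3"
      using that by (metis fst_conv, metis snd_conv)
    have eq: "\<phi> x = (\<chi> i. t $ i + C $ i * x $ i)" if "x \<in> A n" for x
      by (simp add: idx[OF that] \<phi>_def fold_coord_eq t_def C_def \<sigma>_def vec_eq_iff forall_3 diff_divide_distrib algebra_simps)
    have C0: "C $ i \<noteq> 0" for i
      using exhaust_3[of i] L1 lam_gt by (auto simp: C_def \<sigma>_def)
    have im: "\<phi> ` A n = (\<lambda>x. \<chi> i. t $ i + C $ i * x $ i) ` A n" using eq by (intro image_cong) auto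
    have pr: "(\<Prod>i\<in>UNIV. \<bar>C $ i\<bar>) = lam / L\<^sup>2"
      unfolding UNIV_3 using L1 lam_gt by (simp add: C_def \<sigma>_def power2_eq_square abs_divide)
    show ?thesis using diag_affine_image[OF C0 A, of t n] unfolding im pr by simp
  qed
  have UA: "F = (\<Union>n. A n)" by (auto simp: A_def)
  have dA: "disjoint_family A" by (auto simp: disjoint_family_on_def A_def)
  have d\<phi>: "disjoint_family (\<lambda>n. \<phi> ` A n)"
  proof -
    have "\<phi> ` A m \<inter> \<phi> ` A n = {}" if "m \<noteq> n" for m n
      using inj_on_image_Int[OF inj, of "A m" "A n"] that by (auto simp: A_def)
    then show ?thesis by (simp add: disjoint_family_on_def)
  qed
  have im: "\<phi> ` F = (\<Union>n. \<phi> ` A n)" by (auto simp: UA)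
  show "\<phi> ` F \<in> sets borel" unfolding im using * by auto
  have "emeasure lborel (\<phi> ` F) = (\<Sum>n. emeasure lborel (\<phi> ` A n))"
    unfolding im using * d\<phi> by (intro suminf_emeasure[symmetric]) auto
  also have "\<dots> = ennreal (lam / L\<^sup>2) * (\<Sum>n. emeasure lborel (A n))" using * by simp
  also have "(\<Sum>n. emeasure lborel (A n)) = emeasure lborel F"
    unfolding UA using dA by (intro suminf_emeasure) auto
  finally show "emeasure lborel (\<phi> ` F) = ennreal (lam / L\<^sup>2) * emeasure lborel F" .
qed

end

lemma null_sets_hyperplane:
  fixes a :: "real^3"
  assumes "a \<noteq> 0"
  shows "{x. a \<bullet> x = c} \<in> null_sets lborel"
proof -
  have "{x. a \<bullet> x = c} \<in> null_sets lebesgue"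
    using negligible_hyperplane[of a c] assms by (simp add: negligible_iff_null_sets)
  moreover have "closed {x. a \<bullet> x = c}" by (rule closed_hyperplane)
  ultimately show ?thesis by (simp add: null_sets_def)
qed

section \<open>Volume bounds for images, from slabs to integrals\<close>

context zorich_map begin

lemma emeasure_slice_le:
  fixes F :: "(real^3) set"
  assumes F: "F \<in> sets borel" and inj: "inj_on \<phi> F" and up: "\<And>x. x \<in> F \<Longrightarrow> upper x = b"
    and m: "\<And>x. x \<in> F \<Longrightarrow> m \<le> x$3" and B: "B \<in> sets borel" and ZF: "Z ` F \<subseteq> B"
  shows "ennreal (lam / L\<^sup>2 * exp (3 * m)) * emeasure lborel F \<le> emeasure lborel B"
proof -
  have "emeasure lebesgue (\<phi> ` F) \<le> ennreal (exp (- m) ^ DIM(real^3)) * emeasure lebesgue B"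
    using up m B ZF \<phi>_image(1)[OF F inj] by (intro emeasure_lipschitz_image_le[of _ F _ Z] dist_\<phi>_le) auto
  then have "ennreal (lam / L\<^sup>2) * emeasure lborel F \<le> ennreal (exp (- 3 * m)) * emeasure lborel B"
    using B \<phi>_image[OF F inj] by (simp add: exp_of_nat_mult[of 3, simplified, symmetric])
  then have "ennreal (exp (3 * m)) * (ennreal (lam / L\<^sup>2) * emeasure lborel F)
      \<le> ennreal (exp (3 * m)) * (ennreal (exp (- 3 * m)) * emeasure lborel B)"
    by (intro mult_left_mono) auto
  also have "\<dots> = emeasure lborel B"
    by (simp add: mult.assoc[symmetric] ennreal_mult[symmetric] exp_minus_inverse flip: exp_add)
  also have "ennreal (exp (3 * m)) * (ennreal (lam / L\<^sup>2) * emeasure lborel F)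
      = ennreal (lam / L\<^sup>2 * exp (3 * m)) * emeasure lborel F"
    using lam_gt by (subst ennreal_mult) (auto simp: mult_ac)
  finally show ?thesis .
qed

definition J :: "real \<Rightarrow> real^3 \<Rightarrow> real" where "J \<rho> x = \<rho> * exp (3 * x$3)"

lemma J_nonneg: "\<rho> \<ge> 0 \<Longrightarrow> J \<rho> x \<ge> 0" by (simp add: J_def)

lemma borel_measurable_J [measurable]: "J \<rho> \<in> borel_measurable borel"
  unfolding J_def[abs_def] by measurable

text \<open>In a slab of thickness \<epsilon> the weight \<open>J\<close> varies by at most exp(3
  \<epsilon>), exactly what \<rho> falls short of lam / L^2. The norm of \<open>Z x\<close> depends
  on the height only, so different slabs have images in disjoint shells and the estimates add
  up.\<close>

lemma emeasure_half_image_ge: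
  assumes eps: "\<epsilon> > 0" and \<rho>: "\<rho> = lam * exp (- (3 * \<epsilon>)) / L\<^sup>2"
    and F: "F \<in> sets borel" and inj: "inj_on \<phi> F" and up: "\<And>x. x \<in> F \<Longrightarrow> upper x = b"
    and B: "B \<in> sets borel" and ZF: "Z ` F \<subseteq> B"
  shows "emeasure (density lborel (J \<rho>)) F \<le> emeasure lborel B"
proof -
  have \<rho>0: "\<rho> > 0" using lam_gt L1 by (simp add: \<rho>)
  define k where "k x = to_nat \<lfloor>x$3 / \<epsilon>\<rfloor>" for x :: "real^3"
  define k' where "k' y = to_nat \<lfloor>ln (norm y / lam) / \<epsilon>\<rfloor>" for y :: "real^3"
  have [measurable]: "k \<in> borel \<rightarrow>\<^sub>M count_space UNIV" "k' \<in> borel \<rightarrow>\<^sub>M count_space UNIV"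
    unfolding k_def[abs_def] k'_def[abs_def] by measurable
  define A where "A n = F \<inter> {x. k x = n}" for n
  define A' where "A' n = B \<inter> {y. k' y = n}" for n
  have [measurable]: "A n \<in> sets borel" "A' n \<in> sets borel" for n
    unfolding A_def A'_def using F B by measurable
  have dA: "disjoint_family A" "disjoint_family A'" by (auto simp: disjoint_family_on_def A_def A'_def)
  have upA: "x \<in> A n \<Longrightarrow> upper x = b" for x n using up by (simp add: A_def)
  have kk: "k' (Z x) = k x" for x using lam_gt by (simp add: k_def k'_def norm_Z)
  have "emeasure (density lborel (J \<rho>)) (A n) \<le> emeasure lborel (A' n)" for n
  proof -
    define m where "m = of_int (from_nat n) * \<epsilon>"
    have m: "m \<le> x$3" "x$3 \<le> m + \<epsilon>" if "x \<in> A n" for x :: "real^3"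
    proof -
      have "to_nat \<lfloor>x$3 / \<epsilon>\<rfloor> = n" using that by (simp add: A_def k_def)
      then have fl: "\<lfloor>x$3 / \<epsilon>\<rfloor> = from_nat n" by (metis from_nat_to_nat)
      have "of_int (from_nat n) \<le> x$3 / \<epsilon>" "x$3 / \<epsilon> < of_int (from_nat n) + 1"
        unfolding fl[symmetric] by linarith+
      then show "m \<le> x$3" "x$3 \<le> m + \<epsilon>" using eps by (auto simp: m_def field_simps)
    qed
    have Jm: "J \<rho> x \<le> \<rho> * exp (3 * (m + \<epsilon>))" if "x \<in> A n" for x
      using m(2)[OF that] \<rho>0 by (simp add: J_def)
    have "emeasure (density lborel (J \<rho>)) (A n) = (\<integral>\<^sup>+x. ennreal (J \<rho> x) * indicator (A n) x \<partial>lborel)"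
      by (simp add: emeasure_density)
    also have "\<dots> \<le> (\<integral>\<^sup>+x. ennreal (\<rho> * exp (3 * (m + \<epsilon>))) * indicator (A n) x \<partial>lborel)"
      using Jm by (intro nn_integral_mono) (auto split: split_indicator intro!: ennreal_leI)
    also have "\<dots> = ennreal (\<rho> * exp (3 * (m + \<epsilon>))) * emeasure lborel (A n)"
      by (simp add: nn_integral_cmult_indicator)
    also have "\<rho> * exp (3 * (m + \<epsilon>)) = lam / L\<^sup>2 * exp (3 * m)"
      by (simp add: \<rho> exp_add exp_minus field_simps)
    also have "ennreal (lam / L\<^sup>2 * exp (3 * m)) * emeasure lborel (A n) \<le> emeasure lborel (A' n)"
    proof (rule emeasure_slice_le[where b = b])
      show "inj_on \<phi> (A n)" by (rule inj_on_subset[OF inj]) (auto simp: A_def)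
      show "Z ` A n \<subseteq> A' n" using ZF kk by (auto simp: A_def A'_def)
    qed (use m upA in auto)
    finally show ?thesis .
  qed
  then have "(\<Sum>n. emeasure (density lborel (J \<rho>)) (A n)) \<le> (\<Sum>n. emeasure lborel (A' n))"
    by (intro suminf_le) auto
  also have "(\<Sum>n. emeasure (density lborel (J \<rho>)) (A n)) = emeasure (density lborel (J \<rho>)) (\<Union>n. A n)"
    using dA by (intro suminf_emeasure) auto
  also have "(\<Sum>n. emeasure lborel (A' n)) = emeasure lborel (\<Union>n. A' n)"
    using dA by (intro suminf_emeasure) auto
  also have "(\<Union>n. A n) = F" by (auto simp: A_def)
  also have "(\<Union>n. A' n) = B" by (auto simp: A'_def)
  finally show ?thesis .
qed

text \<open>Injectivity of \<open>Z\<close> on \<open>F\<close>, up to the boundary of the half spaces: points with different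
  values of \<open>upper\<close> have images on different sides of the plane \<open>y$3 = 0\<close>.\<close>
definition branch :: "(real^3) set \<Rightarrow> bool" where
  "branch F \<longleftrightarrow> F \<in> sets borel \<and> (\<forall>b. inj_on \<phi> {x \<in> F. upper x = b})"

lemma emeasure_image_ge:
  assumes eps: "\<epsilon> > 0" and \<rho>: "\<rho> = lam * exp (- (3 * \<epsilon>)) / L\<^sup>2"
    and F: "branch F" and B[measurable]: "B \<in> sets borel" and ZF: "Z ` F \<subseteq> B"
  shows "emeasure (density lborel (J \<rho>)) F \<le> emeasure lborel B"
proof -
  have [measurable]: "F \<in> sets borel" using F by (simp add: branch_def)
  define Fb where "Fb b = {x \<in> F. upper x = b}" for b
  have upFb: "x \<in> Fb b \<Longrightarrow> upper x = b" for x b by (simp add: Fb_def)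
  have inj: "inj_on \<phi> (Fb b)" for b using F by (simp add: branch_def Fb_def)
  have [measurable]: "Fb b \<in> sets borel" for b unfolding Fb_def by measurable
  define Bu where "Bu = {y \<in> B. y$3 \<ge> 0}"
  define Bl where "Bl = {y \<in> B. y$3 \<le> 0}"
  have [measurable]: "Bu \<in> sets borel" "Bl \<in> sets borel" unfolding Bu_def Bl_def by measurable
  have Z3: "0 \<le> exp (x$3) * lam * hh (base x) $ 3" for x using lam_gt hh3 by simp
  have "emeasure (density lborel (J \<rho>)) F = emeasure (density lborel (J \<rho>)) (Fb True \<union> Fb False)"
    by (rule arg_cong[where f = "emeasure _"]) (auto simp: Fb_def)
  also have "\<dots> = emeasure (density lborel (J \<rho>)) (Fb True) + emeasure (density lborel (J \<rho>)) (Fb False)"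
    by (intro plus_emeasure[symmetric]) (auto simp: Fb_def)
  also have "\<dots> \<le> emeasure lborel Bu + emeasure lborel Bl"
  proof (intro add_mono)
    show "emeasure (density lborel (J \<rho>)) (Fb True) \<le> emeasure lborel Bu"
    proof (rule emeasure_half_image_ge[OF eps \<rho> _ inj, where b = True])
      show "Z ` Fb True \<subseteq> Bu" using ZF Z3 by (auto simp: Fb_def Bu_def Z_nth)
    qed (auto simp: upFb)
    show "emeasure (density lborel (J \<rho>)) (Fb False) \<le> emeasure lborel Bl"
    proof (rule emeasure_half_image_ge[OF eps \<rho> _ inj, where b = False])
      show "Z ` Fb False \<subseteq> Bl" using ZF Z3 by (auto simp: Fb_def Bl_def Z_nth)
    qed (auto simp: upFb)
  qed
  \<comment> \<open>The two half spaces share a plane; removing it from one makes them disjoint at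
    no cost.\<close>
  also have "emeasure lborel Bl = emeasure lborel (Bl - {y. axis 3 1 \<bullet> y = 0})"
    by (intro emeasure_Diff_null_set[symmetric] null_sets_hyperplane) (auto simp: axis_eq_0_iff)
  also have "emeasure lborel Bu + \<dots> = emeasure lborel (Bu \<union> (Bl - {y. axis 3 1 \<bullet> y = 0}))"
    by (intro plus_emeasure) (auto simp: Bu_def Bl_def inner_axis')
  also have "\<dots> \<le> emeasure lborel B" by (intro emeasure_mono) (auto simp: Bu_def Bl_def)
  finally show ?thesis .
qed

text \<open>Applied to the preimages of all Borel sets, \<open>emeasure_image_ge\<close> says that
  the push-forward of the measure weighted by \<open>J\<close> is at most Lebesgue measure on
  C.\<close>

lemma nn_integral_image_ge:
  assumes eps: "\<epsilon> > 0" and \<rho>: "\<rho> = lam * exp (- (3 * \<epsilon>)) / L\<^sup>2"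
    and F: "branch F" and C[measurable]: "C \<in> sets borel" and ZF: "Z ` F \<subseteq> C"
    and w[measurable]: "w \<in> borel_measurable borel"
  shows "(\<integral>\<^sup>+x. w (Z x) * ennreal (J \<rho> x) * indicator F x \<partial>lborel) \<le> (\<integral>\<^sup>+y. w y * indicator C y \<partial>lborel)"
proof -
  have [measurable]: "F \<in> sets borel" using F by (simp add: branch_def)
  define M where "M = density lborel (\<lambda>x. ennreal (J \<rho> x) * indicator F x)"
  have le: "distr M borel Z \<le> density lborel (indicator C)"
  proof (subst le_measure_iff, simp, intro le_funI)
    fix A
    show "emeasure (distr M borel Z) A \<le> emeasure (density lborel (indicator C)) A"
    proof (cases "A \<in> sets borel")
      case True
      have [measurable]: "Z -` A \<in> sets borel" using measurable_sets[OF borel_measurable_Z True] by simp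
      have "emeasure (distr M borel Z) A = emeasure M (Z -` A)"
        using True by (subst emeasure_distr) (auto simp: M_def)
      also have "\<dots> = emeasure (density lborel (J \<rho>)) (F \<inter> Z -` A)"
        unfolding M_def by (simp add: emeasure_density indicator_inter_arith mult_ac)
      also have "\<dots> \<le> emeasure lborel (A \<inter> C)"
      proof (intro emeasure_image_ge[OF eps \<rho>])
        show "branch (F \<inter> Z -` A)" using F by (auto simp: branch_def inj_on_def)
      qed (use True ZF in auto)
      also have "\<dots> = emeasure (density lborel (indicator C)) A"
        using True by (simp add: emeasure_density Int_commute flip: indicator_inter_arith)
      finally show ?thesis .
    next
      case False
      then show ?thesis by (simp add: emeasure_notin_sets)
    qed
  qed
  have "(\<integral>\<^sup>+x. w (Z x) * ennreal (J \<rho> x) * indicator F x \<partial>lborel) = (\<integral>\<^sup>+x. w (Z x) \<partial>M)"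
    unfolding M_def by (subst nn_integral_density) (auto simp: mult_ac)
  also have "\<dots> = (\<integral>\<^sup>+y. w y \<partial>distr M borel Z)"
    by (subst nn_integral_distr) (auto simp: M_def)
  also have "\<dots> \<le> (\<integral>\<^sup>+y. w y \<partial>density lborel (indicator C))"
    by (intro nn_integral_mono_measure le) simp
  also have "\<dots> = (\<integral>\<^sup>+y. w y * indicator C y \<partial>lborel)"
    by (subst nn_integral_density) (auto simp: mult_ac)
  finally show ?thesis .
qed

end

subsection \<open>Itineraries\<close>

lemma strip_idx_shift:
  assumes "lam > 0"
  shows "strip_idx lam (t + 2 * of_int m * lam) = strip_idx lam t + m"
  using strip_idx_bounds[OF assms, of t] assms
  by (intro strip_idx_eqI) (auto simp: algebra_simps)

lemma fold_coord_shift: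
  assumes "lam > 0"
  shows "fold_coord lam (t + 2 * of_int m * lam) = (if even m then 1 else -1) * fold_coord lam t"
  unfolding fold_coord_eq strip_idx_shift[OF assms] by (auto simp: algebra_simps)

lemma fold_coord_cases:
  assumes "\<bar>t\<bar> < 2 * lam"
  obtains "t < - lam" "strip_idx lam t = - 1" "fold_coord lam t = - 2 * lam - t"
  | "- lam \<le> t" "t < lam" "strip_idx lam t = 0" "fold_coord lam t = t"
  | "lam \<le> t" "strip_idx lam t = 1" "fold_coord lam t = 2 * lam - t"
proof -
  have lam: "lam > 0" using assms by linarith
  consider "t < - lam" | "- lam \<le> t" "t < lam" | "lam \<le> t" by linarith
  then show thesis
  proof cases
    case 1
    then have "strip_idx lam t = - 1" using lam assms by (intro strip_idx_eqI) auto
    with 1 that(1) show thesis by (simp add: fold_coord_eq)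
  next
    case 2
    then have "strip_idx lam t = 0" using lam assms by (intro strip_idx_eqI) auto
    with 2 that(2) show thesis by (simp add: fold_coord_eq)
  next
    case 3
    then have "strip_idx lam t = 1" using lam assms by (intro strip_idx_eqI) auto
    with 3 that(3) show thesis by (simp add: fold_coord_eq)
  qed
qed

lemma fold_coord_pair_even:
  assumes "\<bar>a\<bar> + \<bar>b\<bar> < 2 * lam" "even (strip_idx lam a + strip_idx lam b)"
  shows "a = fold_coord lam a \<and> b = fold_coord lam b"
proof -
  have ab: "\<bar>a\<bar> < 2 * lam" "\<bar>b\<bar> < 2 * lam" using assms(1) by linarith+
  show ?thesis
    by (rule fold_coord_cases[OF ab(1)]; rule fold_coord_cases[OF ab(2)]) (use assms in \<open>auto simp: abs_if split: if_splits\<close>)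
qed

text \<open>The diamond consists of the central square and four outer triangles. The triangles fold
  onto the four parts into which the diagonals cut the square, so comparing |u| with |v| and one
  sign recovers the point.\<close>

lemma fold_coord_pair_odd:
  assumes "\<bar>a\<bar> + \<bar>b\<bar> < 2 * lam" "odd (strip_idx lam a + strip_idx lam b)"
    and u: "u = fold_coord lam a" and v: "v = fold_coord lam b"
  shows "if \<bar>v\<bar> < \<bar>u\<bar> then a = (if u > 0 then 2 * lam - u else - 2 * lam - u) \<and> b = v
         else a = u \<and> b = (if v > 0 then 2 * lam - v else - 2 * lam - v)"
proof -
  have ab: "\<bar>a\<bar> < 2 * lam" "\<bar>b\<bar> < 2 * lam" using assms(1) by linarith+
  show ?thesis
    by (rule fold_coord_cases[OF ab(1)]; rule fold_coord_cases[OF ab(2)])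
       (use assms(1,2) in \<open>auto simp: u v abs_if split: if_splits\<close>)
qed

lemma fold_coord_pair_inj:
  assumes "\<bar>a\<bar> + \<bar>b\<bar> < 2 * lam" "\<bar>a'\<bar> + \<bar>b'\<bar> < 2 * lam"
    and "fold_coord lam a = fold_coord lam a'" "fold_coord lam b = fold_coord lam b'"
    and "even (strip_idx lam a + strip_idx lam b) = even (strip_idx lam a' + strip_idx lam b')"
  shows "a = a' \<and> b = b'"
proof (cases "even (strip_idx lam a + strip_idx lam b)")
  case True
  then show ?thesis
    using fold_coord_pair_even[OF assms(1)] fold_coord_pair_even[OF assms(2)] assms(3-5) by metis
next
  case False
  then show ?thesis
    using fold_coord_pair_odd[OF assms(1) _ refl refl] fold_coord_pair_odd[OF assms(2) _ refl refl] assms(3-5)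
    by (metis (full_types))
qed

section \<open>Tiles and cells as domains of injectivity\<close>

lemma sets_Ttile [measurable]: "Ttile lam s \<in> sets borel"
proof -
  have "Measurable.pred borel (\<lambda>x. T00 lam x)"
    unfolding T00_def[abs_def] Let_def by measurable
  then show ?thesis unfolding Ttile_def by measurable
qed

text \<open>On all of \<open>Ttile\<close> the map is not injective: the two halves of a boundary edge of the tile
  have the same image.\<close>
definition tile_core :: "real \<Rightarrow> int \<times> int \<Rightarrow> (real^3) set" where
  "tile_core lam s = {x. \<bar>x$1 - x$2 - 4 * of_int (snd s) * lam\<bar> < 2 * lam \<and> \<bar>x$1 + x$2 - 4 * of_int (fst s) * lam\<bar> < 2 * lam}"

lemma sets_tile_core [measurable]: "tile_core lam s \<in> sets borel"
  unfolding tile_core_def by measurable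

lemma Ttile_bounds:
  fixes x :: "real^3"
  assumes "x \<in> Ttile lam s" "lam > 0"
  shows "\<bar>x$1 - x$2 - 4 * of_int (snd s) * lam\<bar> \<le> 2 * lam" "\<bar>x$1 + x$2 - 4 * of_int (fst s) * lam\<bar> \<le> 2 * lam"
proof -
  define P where "P = of_int (fst s) * lam"
  define Q where "Q = of_int (snd s) * lam"
  define a where "a = x$1 - (2 * P + 2 * Q)"
  define b where "b = x$2 - (2 * P - 2 * Q)"
  have "T00 lam (vector [a, b, x$3])"
  proof -
    have "x - vector [2 * of_int (fst s) * lam + 2 * of_int (snd s) * lam,
        2 * of_int (fst s) * lam - 2 * of_int (snd s) * lam, 0] = vector [a, b, x$3]"
      by (simp add: vec_eq_iff forall_3 a_def b_def P_def Q_def)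
    then show ?thesis using assms(1) by (simp add: Ttile_def)
  qed
  then have "\<bar>a - b\<bar> \<le> 2 * lam" "\<bar>a + b\<bar> \<le> 2 * lam"
    using assms(2) by (auto simp: T00_def Let_def)
  moreover have "a - b = x$1 - x$2 - 4 * of_int (snd s) * lam" "a + b = x$1 + x$2 - 4 * of_int (fst s) * lam"
    by (simp_all add: a_def b_def P_def Q_def)
  ultimately show "\<bar>x$1 - x$2 - 4 * of_int (snd s) * lam\<bar> \<le> 2 * lam"
    "\<bar>x$1 + x$2 - 4 * of_int (fst s) * lam\<bar> \<le> 2 * lam" by simp_all
qed

lemma AE_Ttile_core:
  assumes "lam > 0"
  shows "AE x in lborel. x \<in> Ttile lam s \<longrightarrow> x \<in> tile_core lam s"
proof -
  define H where "H a c = {x :: real^3. a \<bullet> x = c}" for a c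
  have "AE x in lborel. x \<notin> H (vector [1, -1, 0]) c" "AE x in lborel. x \<notin> H (vector [1, 1, 0]) c" for c
    unfolding H_def by (intro AE_not_in null_sets_hyperplane; simp add: vec_eq_iff forall_3)+
  note this[of "4 * of_int (snd s) * lam + 2 * lam"] this[of "4 * of_int (snd s) * lam - 2 * lam"]
    this[of "4 * of_int (fst s) * lam + 2 * lam"] this[of "4 * of_int (fst s) * lam - 2 * lam"]
  then show ?thesis
  proof eventually_elim
    case (elim x)
    then show ?case using Ttile_bounds[OF _ assms, of x s]
      by (auto simp: H_def tile_core_def inner_vec_def sum_3)
  qed
qed

context zorich_map begin

lemma \<phi>_eqD:
  fixes x y :: "real^3"
  assumes "\<phi> x = \<phi> y"
  shows "fold_coord lam (x$1) = fold_coord lam (y$1)" "fold_coord lam (x$2) = fold_coord lam (y$2)" "x$3 = y$3"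
  using assms lam_gt L1 by (simp_all add: \<phi>_def vec_eq_iff forall_3)

lemma branch_subset_tile_core:
  assumes "G \<in> sets borel" "G \<subseteq> tile_core lam s"
  shows "branch G"
  unfolding branch_def
proof (intro conjI allI inj_onI)
  fix b and x y :: "real^3" assume xy: "x \<in> {x \<in> G. upper x = b}" "y \<in> {x \<in> G. upper x = b}" and eq: "\<phi> x = \<phi> y"
  \<comment> \<open>The tile is centred at (2 c lam, 2 d lam). Recentring changes folded coordinates
    by signs and strip indices by constants common to x and y, which reduces the claim to the
    diamond.\<close>
  define c where "c = fst s + snd s"
  define d where "d = fst s - snd s"
  define u where "u z = z$1 - 2 * of_int c * lam" for z :: "real^3"
  define v where "v z = z$2 - 2 * of_int d * lam" for z :: "real^3"
  have uv: "z$1 = u z + 2 * of_int c * lam" "z$2 = v z + 2 * of_int d * lam" for z :: "real^3"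
    by (simp_all add: u_def v_def)
  have in_core: "\<bar>u z\<bar> + \<bar>v z\<bar> < 2 * lam" if "z \<in> G" for z
    using subsetD[OF assms(2) that] by (auto simp: tile_core_def u_def v_def c_def d_def algebra_simps abs_if split: if_splits)
  have "u x = u y \<and> v x = v y"
  proof (rule fold_coord_pair_inj[of _ _ lam])
    show "\<bar>u x\<bar> + \<bar>v x\<bar> < 2 * lam" "\<bar>u y\<bar> + \<bar>v y\<bar> < 2 * lam" using xy in_core by auto
    show "fold_coord lam (u x) = fold_coord lam (u y)" "fold_coord lam (v x) = fold_coord lam (v y)"
      using \<phi>_eqD(1,2)[OF eq] unfolding uv fold_coord_shift[OF lam_gt(2)] by (auto split: if_splits)
    have "upper x = upper y" using xy by auto
    then show "even (strip_idx lam (u x) + strip_idx lam (v x)) = even (strip_idx lam (u y) + strip_idx lam (v y))"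
      unfolding upper_def uv strip_idx_shift[OF lam_gt(2)] by auto
  qed
  then show "x = y" using \<phi>_eqD(3)[OF eq] by (simp add: vec_eq_iff forall_3 uv)
qed (use assms in auto)

text \<open>Countably many pieces covering space, for use where no tile is prescribed.\<close>

definition cell :: "nat \<Rightarrow> (real^3) set" where
  "cell n = {x. to_nat (strip_idx lam (x$1), strip_idx lam (x$2)) = n}"

lemma sets_cell [measurable]: "cell n \<in> sets borel"
  unfolding cell_def by measurable

lemma branch_subset_cell:
  assumes "G \<in> sets borel" "G \<subseteq> cell n"
  shows "branch G"
  unfolding branch_def
proof (intro conjI allI inj_onI)
  fix b and x y :: "real^3" assume xy: "x \<in> {x \<in> G. upper x = b}" "y \<in> {x \<in> G. upper x = b}" and eq: "\<phi> x = \<phi> y"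
  then have "x \<in> cell n" "y \<in> cell n" using assms by auto
  then have "strip_idx lam (x$1) = strip_idx lam (y$1)" "strip_idx lam (x$2) = strip_idx lam (y$2)"
    by (auto simp: cell_def dest: injD[OF inj_to_nat] intro: to_nat_split)
  then show "x = y" using \<phi>_eqD[OF eq] by (auto simp: vec_eq_iff forall_3 fold_coord_eq split: if_splits)
qed (use assms in auto)

end

lemma prod_3: "prod f (UNIV :: 3 set) = f 1 * f 2 * (f 3 :: real)"
  unfolding UNIV_3 by (simp add: ac_simps)

lemma emeasure_cbox3:
  fixes a b :: "real^3"
  assumes "\<forall>i. a $ i \<le> b $ i"
  shows "emeasure lborel (cbox a b) = ennreal ((b$1 - a$1) * (b$2 - a$2) * (b$3 - a$3))"
proof -
  have "cbox a b \<noteq> {}" using assms by (simp add: interval_ne_empty_cart)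
  then have "measure lborel (cbox a b) = (b$1 - a$1) * (b$2 - a$2) * (b$3 - a$3)"
    by (simp add: content_cbox_cart prod_3)
  then show ?thesis
    using emeasure_lborel_cbox_finite[of a b] by (subst emeasure_eq_ennreal_measure) (auto simp: less_top)
qed

text \<open>All tiles are horizontal translates of one beam, so the bound is uniform in s, as it
  must be when the tile changes with time.\<close>

lemma nn_integral_Ttile_bounded:
  assumes lam: "lam > 0"
  obtains K where "K \<ge> 0"
    "\<And>s. (\<integral>\<^sup>+x. ennreal (1 / (1 + (x$3)\<^sup>2)) * indicator (Ttile lam s) x \<partial>lborel) \<le> ennreal K"
proof
  \<comment> \<open>Heights of modulus between n and n + 1 fill two boxes of volume 16 lam^2, one
    above and one below the plane.\<close>
  define K where "K = (\<Sum>n. 32 * lam\<^sup>2 * (1 / (1 + (real n)\<^sup>2)))"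
  have sm: "summable (\<lambda>n. 32 * lam\<^sup>2 * (1 / (1 + (real n)\<^sup>2)))"
  proof (intro summable_mult, rule summable_comparison_test')
    show "summable (\<lambda>n. inverse (real n ^ 2))" by (rule inverse_power_summable) simp
    show "norm (1 / (1 + (real n)\<^sup>2)) \<le> inverse ((real n)\<^sup>2)" if "n \<ge> 1" for n
      using that le_imp_inverse_le[of "(real n)\<^sup>2" "1 + (real n)\<^sup>2"] by (simp add: inverse_eq_divide)
  qed
  then show "K \<ge> 0" unfolding K_def by (intro suminf_nonneg) auto
  fix s
  define S where "S n = {x \<in> Ttile lam s. nat \<lfloor>\<bar>x$3\<bar>\<rfloor> = n}" for n
  have [measurable]: "S n \<in> sets borel" for n unfolding S_def by measurable
  define M where "M = density lborel (\<lambda>x :: real^3. ennreal (1 / (1 + (x$3)\<^sup>2)))"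
  have M: "emeasure M (S n) \<le> ennreal (32 * lam\<^sup>2 * (1 / (1 + (real n)\<^sup>2)))" for n
  proof -
    define c where "c = 2 * (of_int (fst s) + of_int (snd s)) * lam"
    define d where "d = 2 * (of_int (fst s) - of_int (snd s)) * lam"
    define B where "B t = cbox (vector [c - 2 * lam, d - 2 * lam, t] :: real^3) (vector [c + 2 * lam, d + 2 * lam, t + 1])" for t
    have B: "emeasure lborel (B t) = ennreal (16 * lam\<^sup>2)" for t
      unfolding B_def using lam by (subst emeasure_cbox3) (auto simp: forall_3 power2_eq_square)
    have nx: "real n \<le> \<bar>x$3\<bar> \<and> \<bar>x$3\<bar> \<le> real n + 1" if "x \<in> S n" for x :: "real^3"
    proof -
      have "nat \<lfloor>\<bar>x$3\<bar>\<rfloor> = n" using that by (simp add: S_def)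
      then have "\<lfloor>\<bar>x$3\<bar>\<rfloor> = int n" by (metis abs_ge_zero int_nat_eq zero_le_floor)
      then show ?thesis by linarith
    qed
    have sub: "S n \<subseteq> B (real n) \<union> B (- real n - 1)"
    proof
      fix x assume x: "x \<in> S n"
      then have "x \<in> Ttile lam s" by (simp add: S_def)
      note Ttile_bounds[OF this lam]
      moreover have "\<bar>x$1 - c\<bar> \<le> 2 * lam" "\<bar>x$2 - d\<bar> \<le> 2 * lam"
        using calculation unfolding c_def d_def by (auto simp: algebra_simps abs_if split: if_splits)
      ultimately show "x \<in> B (real n) \<union> B (- real n - 1)"
        using nx[OF x] by (auto simp: B_def mem_box_cart forall_3 abs_if split: if_splits)
    qed
    have "emeasure M (S n) = (\<integral>\<^sup>+x. ennreal (1 / (1 + (x$3)\<^sup>2)) * indicator (S n) x \<partial>lborel)"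
      by (simp add: M_def emeasure_density)
    also have "\<dots> \<le> (\<integral>\<^sup>+x. ennreal (1 / (1 + (real n)\<^sup>2)) * indicator (S n) x \<partial>lborel)"
    proof (intro nn_integral_mono)
      fix x :: "real^3"
      show "ennreal (1 / (1 + (x$3)\<^sup>2)) * indicator (S n) x \<le> ennreal (1 / (1 + (real n)\<^sup>2)) * indicator (S n) x"
      proof (cases "x \<in> S n")
        case True
        have "(real n)\<^sup>2 \<le> (x$3)\<^sup>2" using nx[OF True] by (metis abs_of_nat abs_le_square_iff)
        then show ?thesis using True
          by (auto intro!: ennreal_leI divide_left_mono mult_pos_pos add_pos_nonneg)
      qed simp
    qed
    also have "\<dots> = ennreal (1 / (1 + (real n)\<^sup>2)) * emeasure lborel (S n)"
      by (simp add: nn_integral_cmult_indicator)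
    also have "emeasure lborel (S n) \<le> emeasure lborel (B (real n) \<union> B (- real n - 1))"
      using sub by (intro emeasure_mono) (auto simp: B_def)
    also have "\<dots> \<le> emeasure lborel (B (real n)) + emeasure lborel (B (- real n - 1))"
      by (intro emeasure_subadditive) (auto simp: B_def)
    also have "\<dots> = ennreal (32 * lam\<^sup>2)"
      unfolding B by (subst ennreal_plus[symmetric]) auto
    finally have "emeasure M (S n) \<le> ennreal (1 / (1 + (real n)\<^sup>2)) * ennreal (32 * lam\<^sup>2)"
      by (simp add: mult_left_mono)
    then show ?thesis by (simp add: ennreal_mult'[symmetric] mult_ac)
  qed
  have "(\<integral>\<^sup>+x. ennreal (1 / (1 + (x$3)\<^sup>2)) * indicator (Ttile lam s) x \<partial>lborel) = emeasure M (Ttile lam s)"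
    by (simp add: M_def emeasure_density)
  also have "\<dots> = emeasure M (\<Union>n. S n)" by (rule arg_cong[where f = "emeasure M"]) (auto simp: S_def)
  also have "\<dots> \<le> (\<Sum>n. emeasure M (S n))"
    by (intro emeasure_subadditive_countably) (auto simp: M_def)
  also have "\<dots> \<le> (\<Sum>n. ennreal (32 * lam\<^sup>2 * (1 / (1 + (real n)\<^sup>2))))"
    using M by (intro suminf_le) auto
  also have "\<dots> = ennreal K"
    unfolding K_def using sm by (intro suminf_ennreal2) auto
  finally show "(\<integral>\<^sup>+x. ennreal (1 / (1 + (x$3)\<^sup>2)) * indicator (Ttile lam s) x \<partial>lborel) \<le> ennreal K" .
qed

section \<open>The fibers are null sets\<close>

context zorich_map begin

text \<open>Unlike \<open>itinerary_fiber\<close>, this also prescribes the tile of the starting point.\<close>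
definition fiber0 :: "(nat \<Rightarrow> int \<times> int) \<Rightarrow> (real^3) set" where
  "fiber0 t = {x. \<forall>k. (Z ^^ k) x \<in> Ttile lam (t k)}"

lemma sets_fiber0 [measurable]: "fiber0 t \<in> sets borel"
  unfolding fiber0_def by measurable

lemma Z_fiber0: "x \<in> fiber0 t \<Longrightarrow> Z x \<in> fiber0 (\<lambda>k. t (Suc k))"
  unfolding fiber0_def by (simp flip: funpow_swap1) (metis comp_apply funpow.simps(2))

text \<open>The first application of \<open>Z\<close> is peeled off, not the last: it takes the
  fiber into that of the shifted sequence, to which the induction hypothesis applies.\<close>

lemma nn_integral_fiber0_le:
  assumes eps: "\<epsilon> > 0" and \<rho>: "\<rho> = lam * exp (- (3 * \<epsilon>)) / L\<^sup>2"
    and w[measurable]: "w \<in> borel_measurable borel"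
  shows "(\<integral>\<^sup>+x. w ((Z ^^ n) x) * ennreal (\<Prod>i<n. J \<rho> ((Z ^^ i) x)) * indicator (fiber0 t) x \<partial>lborel)
     \<le> (\<integral>\<^sup>+y. w y * indicator (Ttile lam (t n)) y \<partial>lborel)"
proof (induction n arbitrary: t)
  case 0
  show ?case by (intro nn_integral_mono) (auto simp: fiber0_def split: split_indicator dest: spec[of _ 0])
next
  case (Suc n)
  have \<rho>0: "\<rho> > 0" using lam_gt L1 by (simp add: \<rho>)
  define W where "W y = w ((Z ^^ n) y) * ennreal (\<Prod>i<n. J \<rho> ((Z ^^ i) y))" for y
  have [measurable]: "W \<in> borel_measurable borel"
    unfolding W_def[abs_def] by measurable
  have eq: "w ((Z ^^ Suc n) x) * ennreal (\<Prod>i<Suc n. J \<rho> ((Z ^^ i) x)) = W (Z x) * ennreal (J \<rho> x)" for x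
    unfolding W_def prod.lessThan_Suc_shift using \<rho>0
    by (simp add: funpow_swap1 ennreal_mult J_nonneg prod_nonneg mult_ac)
  define F where "F = fiber0 t \<inter> tile_core lam (t 0)"
  have "AE x in lborel. x \<in> fiber0 t \<longrightarrow> x \<in> F"
    using AE_Ttile_core[OF lam_gt(2), of "t 0"]
    by eventually_elim (auto simp: F_def fiber0_def dest: spec[of _ 0])
  then have "(\<integral>\<^sup>+x. W (Z x) * ennreal (J \<rho> x) * indicator (fiber0 t) x \<partial>lborel)
      \<le> (\<integral>\<^sup>+x. W (Z x) * ennreal (J \<rho> x) * indicator F x \<partial>lborel)"
    by (intro nn_integral_mono_AE, eventually_elim) (auto split: split_indicator)
  also have "\<dots> \<le> (\<integral>\<^sup>+y. W y * indicator (fiber0 (\<lambda>k. t (Suc k))) y \<partial>lborel)"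
    using Z_fiber0 by (intro nn_integral_image_ge[OF eps \<rho>] branch_subset_tile_core[of _ "t 0"]) (auto simp: F_def)
  also have "\<dots> \<le> (\<integral>\<^sup>+y. w y * indicator (Ttile lam (t (Suc n))) y \<partial>lborel)"
    unfolding W_def by (rule Suc.IH)
  finally show ?case unfolding eq .
qed

lemma fiber0_null: "fiber0 t \<in> null_sets lborel"
proof -
  \<comment> \<open>Makes lam / L^5 = exp(6 \<epsilon>). Giving up exp(3 \<epsilon>) for the slabs
    leaves \<rho> / L^3 = exp(3 \<epsilon>), with room for \<theta> = exp \<epsilon> below
    it.\<close>
  define \<epsilon> where "\<epsilon> = ln (lam / L ^ 5) / 6"
  have "lam / L ^ 5 > 1" using lam5 L1 by simp
  then have eps: "\<epsilon> > 0" by (simp add: \<epsilon>_def)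
  define \<rho> where "\<rho> = lam * exp (- (3 * \<epsilon>)) / L\<^sup>2"
  have \<rho>0: "\<rho> > 0" using lam_gt L1 by (simp add: \<rho>_def)
  have "exp (6 * \<epsilon>) = lam / L ^ 5" using \<open>lam / L ^ 5 > 1\<close> by (simp add: \<epsilon>_def)
  then have "\<rho> / L ^ 3 = exp (6 * \<epsilon>) * exp (- (3 * \<epsilon>))"
    by (simp add: \<rho>_def flip: power_add)
  then have c: "\<rho> / L ^ 3 = exp (3 * \<epsilon>)" by (simp flip: exp_add)
  define \<theta> where "\<theta> = exp \<epsilon>"
  have \<theta>: "\<theta> > 1" "\<theta> < \<rho> / L ^ 3" using eps by (auto simp: c \<theta>_def)
  obtain K where K: "K \<ge> 0"
    "\<And>s. (\<integral>\<^sup>+x. ennreal (1 / (1 + (x$3)\<^sup>2)) * indicator (Ttile lam s) x \<partial>lborel) \<le> ennreal K"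
    using nn_integral_Ttile_bounded[OF lam_gt(2)] by blast
  define P where "P n x = (\<Prod>i<n. J \<rho> ((Z ^^ i) x))" for n x
  \<comment> \<open>By Markov's inequality for the weighted integral, \<open>E n\<close> has measure
    at most K / \<theta>^n, which is summable.\<close>
  define E where "E n = {x \<in> fiber0 t. \<theta> ^ n * (1 + ((Z ^^ n) x $ 3)\<^sup>2) \<le> P n x}" for n
  have [measurable]: "P n \<in> borel_measurable borel" for n unfolding P_def[abs_def] by measurable
  have [measurable]: "(\<lambda>x. (Z ^^ n) x $ 3) \<in> borel_measurable borel" for n
    by (rule measurable_compose[OF borel_measurable_Z_funpow borel_measurable_nth])
  have E[measurable]: "E n \<in> sets borel" for n unfolding E_def by measurable
  have em3: "ennreal (a * (b * c)) = ennreal a * (ennreal b * ennreal c)" if "0 \<le> a" "0 \<le> b" "0 \<le> c" for a b c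
    using that by (simp add: ennreal_mult)
  have em: "emeasure lborel (E n) \<le> ennreal (K * (1 / \<theta>) ^ n)" for n
  proof -
    have "emeasure lborel (E n) = (\<integral>\<^sup>+x. indicator (E n) x \<partial>lborel)" by simp
    also have "\<dots> \<le> (\<integral>\<^sup>+x. ennreal ((1 / \<theta>) ^ n) *
        (ennreal (1 / (1 + ((Z ^^ n) x $ 3)\<^sup>2)) * ennreal (P n x) * indicator (fiber0 t) x) \<partial>lborel)"
    proof (intro nn_integral_mono)
      fix x
      show "indicator (E n) x \<le> ennreal ((1 / \<theta>) ^ n) *
        (ennreal (1 / (1 + ((Z ^^ n) x $ 3)\<^sup>2)) * ennreal (P n x) * indicator (fiber0 t) x)"
      proof (cases "x \<in> E n")
        case True
        define q where "q = 1 + ((Z ^^ n) x $ 3)\<^sup>2"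
        have q: "q > 0" unfolding q_def by (smt (verit) zero_le_power2)
        have "\<theta> ^ n * q \<le> P n x" using True by (simp add: E_def q_def)
        then have "1 \<le> (1 / \<theta>) ^ n * (1 / q * P n x)"
          using q \<theta> by (simp add: field_simps)
        then have "ennreal 1 \<le> ennreal ((1 / \<theta>) ^ n * (1 / q * P n x))" by (rule ennreal_leI)
        also have "\<dots> = ennreal ((1 / \<theta>) ^ n) * (ennreal (1 / q) * ennreal (P n x))"
          using q \<theta> \<rho>0 by (intro em3) (auto simp: P_def prod_nonneg J_nonneg)
        finally show ?thesis using True by (simp add: q_def E_def)
      qed simp
    qed
    also have "\<dots> = ennreal ((1 / \<theta>) ^ n) * (\<integral>\<^sup>+x. ennreal (1 / (1 + ((Z ^^ n) x $ 3)\<^sup>2)) * ennreal (P n x) * indicator (fiber0 t) x \<partial>lborel)"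
      by (intro nn_integral_cmult) measurable
    also have "\<dots> \<le> ennreal ((1 / \<theta>) ^ n) * ennreal K"
    proof (intro mult_left_mono order_trans[OF _ K(2)])
      show "(\<integral>\<^sup>+x. ennreal (1 / (1 + ((Z ^^ n) x $ 3)\<^sup>2)) * ennreal (P n x) * indicator (fiber0 t) x \<partial>lborel)
        \<le> (\<integral>\<^sup>+y. ennreal (1 / (1 + (y$3)\<^sup>2)) * indicator (Ttile lam (t n)) y \<partial>lborel)"
        unfolding P_def
        by (rule nn_integral_fiber0_le[OF eps \<rho>_def, where w = "\<lambda>y :: real^3. ennreal (1 / (1 + (y$3)\<^sup>2))"]) measurable
    qed simp
    also have "\<dots> = ennreal (K * (1 / \<theta>) ^ n)" using K(1) \<theta> by (simp add: ennreal_mult mult.commute)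
    finally show ?thesis .
  qed
  have "AE x in lborel. eventually (\<lambda>n. x \<in> space lborel - E n) sequentially"
  proof (rule borel_cantelli_AE1)
    show "E n \<in> sets lborel" for n by simp
    show "emeasure lborel (E n) < \<infinity>" for n using em[of n] by (rule le_less_trans) simp
    show "summable (\<lambda>n. measure lborel (E n))"
    proof (rule summable_comparison_test')
      show "summable (\<lambda>n. K * (1 / \<theta>) ^ n)" using \<theta> by (intro summable_mult summable_geometric) auto
      show "norm (measure lborel (E n)) \<le> K * (1 / \<theta>) ^ n" for n
        using em[of n] K \<theta> by (simp add: measure_def enn2real_leI)
    qed
  qed
  \<comment> \<open>On the invariant plane D vanishes and \<open>D_orbit\<close> says
    nothing.\<close>
  moreover have "AE x in lborel. x \<notin> {x :: real^3. vector [1, -1, 0] \<bullet> x = 0}"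
    by (intro AE_not_in null_sets_hyperplane) (simp add: vec_eq_iff forall_3)
  ultimately have "AE x in lborel. x \<notin> fiber0 t"
  proof eventually_elim
    case (elim x)
    show ?case
    proof
      assume "x \<in> fiber0 t"
      then have "eventually (\<lambda>n. (\<Prod>i<n. \<rho> * exp (3 * (Z ^^ i) x $ 3)) < \<theta> ^ n * (1 + ((Z ^^ n) x $ 3)\<^sup>2)) sequentially"
        using elim(1) by (auto elim!: eventually_mono simp: E_def P_def J_def)
      moreover have "D x > 0" using elim(2) by (simp add: D_def inner_vec_def sum_3)
      ultimately show False using orbit_growth_impossible[of x \<theta> \<rho>] \<theta> by blast
    qed
  qed
  then show ?thesis by (subst (asm) AE_iff_null_sets[symmetric]) auto
qed

text \<open>Itineraries start with the tile of \<open>Z x\<close>, so the fiber is the preimage of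
  \<open>fiber0 s\<close>. The density \<open>J\<close> is positive, hence on each cell the preimage
  of a null set is null.\<close>

lemma itinerary_fiber_null: "itinerary_fiber Z lam s \<in> null_sets lborel"
proof -
  define A where "A = itinerary_fiber Z lam s"
  have "itinerary_fiber Z lam s = Z -` fiber0 s"
    by (auto simp: itinerary_fiber_def fiber0_def funpow_swap1)
  then have [measurable]: "A \<in> sets borel" and ZA: "Z ` A \<subseteq> fiber0 s"
    using measurable_sets[OF borel_measurable_Z sets_fiber0] by (auto simp: A_def)
  \<comment> \<open>Any positive \<rho> serves here, so slabs of thickness 1 will do.\<close>
  define \<rho> where "\<rho> = lam * exp (- (3 * 1)) / L\<^sup>2"
  have \<rho>0: "\<rho> > 0" using lam_gt L1 by (simp add: \<rho>_def)
  have "A \<inter> cell n \<in> null_sets lborel" for n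
  proof -
    have "emeasure (density lborel (J \<rho>)) (A \<inter> cell n) \<le> emeasure lborel (fiber0 s)"
      using ZA by (intro emeasure_image_ge[OF zero_less_one \<rho>_def] branch_subset_cell[of _ n]) auto
    then have "emeasure (density lborel (J \<rho>)) (A \<inter> cell n) = 0"
      using fiber0_null[of s] by (simp add: null_sets_def)
    then have "A \<inter> cell n \<in> null_sets (density lborel (J \<rho>))" by (simp add: null_sets_def)
    then have "AE x in lborel. x \<in> A \<inter> cell n \<longrightarrow> ennreal (J \<rho> x) = 0"
      by (subst (asm) null_sets_density_iff) auto
    then have "AE x in lborel. x \<notin> A \<inter> cell n"
      using \<rho>0 by (auto simp: J_def)
    then show ?thesis by (subst (asm) AE_iff_null_sets[symmetric]) auto
  qed
  then have "(\<Union>n. A \<inter> cell n) \<in> null_sets lborel" by (intro null_sets_UN) auto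
  moreover have "(\<Union>n. A \<inter> cell n) = A" by (auto simp: cell_def)
  ultimately show ?thesis by (simp add: A_def)
qed

end

theorem theorem8p1:
  fixes hh :: "real^2 \<Rightarrow> real^3" and L lam :: real and s :: "nat \<Rightarrow> int \<times> int"
  assumes L: "L \<ge> 1"
    and bilip: "\<forall>a\<in>sqQ. \<forall>b\<in>sqQ. dist a b / L \<le> dist (hh a) (hh b) \<and> dist (hh a) (hh b) \<le> L * dist a b"
    and onto: "hh ` sqQ = upper_hemisphere"
    and bd: "hh ` sqQ_boundary = equator"
    and sp: "sense_preserving_hemi hh"
    and sym1: "\<forall>t::real. -1 \<le> t \<and> t \<le> 1 \<longrightarrow> hh (vector [t, t]) $ 1 = hh (vector [t, t]) $ 2"
    and sym2: "\<forall>t::real. -1 \<le> t \<and> t \<le> 1 \<longrightarrow> hh (vector [t, -t]) $ 1 = - (hh (vector [t, -t]) $ 2)"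
    and lam: "lam > max (L ^ 5) (2 * L)"
  shows "itinerary_fiber (zorich hh lam 1) lam s \<in> null_sets lebesgue"
proof -
  interpret zorich_map hh L lam
    using assms by unfold_locales auto
  show ?thesis using itinerary_fiber_null by (rule null_sets_completionI)
qed

end
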